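(* Let $\mathcal M(R,F)$ be a quantum matrix algebra of BMW-type. Let $\mathcal M^{\bullet}(R,F)$ be the extension of $\mathcal M(R,F)$ by a generator $g^{-1}$ subject to the relations $$g^{-1}g=g\,g^{-1}=1,\qquad g^{-1}M=(G^{-1}MG)\,g^{-1}.$$ Then $\mathcal M^{\bullet}(R,F)$ contains the entries of an inverse matrix to $M$, namely $$M^{-1}:=\mu\,\xi(M)\,g^{-1},\qquad M\cdot M^{-1}=M^{-1}\cdot M=I .$$
   Context: Operators. $V$ is a complex vector space of finite dimension $N$ with a fixed basis (operators on $V^{\otimes n}$ are matrices), $I$ the identity, $P$ the flip on $V\otimes V$. For $X\in\mathrm{End}(V^{\otimes 2})$, $X_{mr}$ is $X$ acting in the tensor factors $m,r$ and trivially elsewhere, $X_m:=X_{m\,m+1}$; for an $N\times N$ matrix $Y$, $Y_m$ is $Y$ in factor $m$. $\mathrm{Tr}_{(i)}$ is the trace over the $i$-th factor. $X$ is skew invertible if there is $\Psi_X\in\mathrm{End}(V^{\otimes2})$ with $\mathrm{Tr}_{(2)}X_{12}(\Psi_X)_{23}=\mathrm{Tr}_{(2)}(\Psi_X)_{12}X_{23}=P_{13}$; then $C_X:=\mathrm{Tr}_{(1)}(\Psi_X)_{12}$, $D_X:=\mathrm{Tr}_{(2)}(\Psi_X)_{12}$, and $X$ is strict skew invertible if $C_X$ or $D_X$ is invertible. An R-matrix is an invertible $R\in\mathrm{End}(V^{\otimes 2})$ with $R_1R_2R_1=R_2R_1R_2$. A pair $\{R,F\}$ is compatible if $R_1F_2F_1=F_2F_1R_2$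 and $R_2F_1F_2=F_1F_2R_1$. For skew invertible $R$ the R-trace over spaces $i_1,\dots,i_s$ is $\mathrm{Tr}_{R(i_1,\dots,i_s)}X:=\mathrm{Tr}_{(i_1,\dots,i_s)}\big((D_R)_{i_1}\cdots(D_R)_{i_s}X\big)$. BMW-type. Let $q\in\mathbb C\setminus\{0,\pm1\}$, $\mu\in\mathbb C\setminus\{0,q,-q^{-1}\}$, $\eta:=\frac{(q-\mu)(q^{-1}+\mu)}{\mu(q-q^{-1})}$. An R-matrix $R$ is of BMW-type if its minimal polynomial relation is $(qI-R)(q^{-1}I+R)(\mu I-R)=0$ and $K:=\mu^{-1}(q-q^{-1})^{-1}(qI-R)(q^{-1}I+R)$ satisfies $K_2K_1=R_1^{\pm1}R_2^{\pm1}K_1$ and $K_1K_2K_1=K_1$. Quantum matrix algebra. Let $\{R,F\}$ be a compatible pair of strict skew invertible R-matrices. For an $N\times N$ matrix $M$ put $M_{\overline1}:=M_1$, $M_{\overline i}:=F_{i-1}M_{\overline{i-1}}F_{i-1}^{-1}$. $\mathcal M(R,F)$ is the unital associative $\mathbb C$-algebra generated by the entries $M_a^b$ of $M$ with relations $R_1M_{\overline1}M_{\overline2}=M_{\overline1}M_{\overline2}R_1$; it is of BMW-type if $R$ is. The 2-contraction is $g:=\eta^{-1}\mathrm{Tr}_{R(1,2)}(M_{\overline1}M_{\overline2}K_1)\in\mathcal M(R,F)$. $G\in\mathrm{End}(V)$ is defined by $G_1:=\mathrm{Tr}_{(23)}K_2F_1^{-1}F_2^{-1}$; it is invertible with $G_1^{-1}=\mathrm{Tr}_{(23)}F_2F_1K_2$.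 In $\mathcal M(R,F)$ one has $Mg=g(G^{-1}MG)$. The map $\xi$ is $\xi(N)_1:=\mathrm{Tr}_{R(2)}(F_{12}N_1F_{12}^{-1}K_{12})$. "$\cdot$" is the usual matrix product. *)

theory Defs
  imports
    "HOL-Analysis.Analysis"
    "HOL-Computational_Algebra.Polynomial"
    "HOL-Library.Poly_Mapping"
    "HOL-Algebra.QuotRing"
begin

section \<open>Operators on tensor powers of \<open>V\<close>\<close>

text \<open>
  \<open>V\<close> has a basis indexed by a finite type \<open>'n\<close>, so that operators on \<open>V\<close>, \<open>V \<otimes> V\<close> and
  \<open>V \<otimes> V \<otimes> V\<close> are square matrices indexed by \<open>'n\<close>, \<open>'n \<times> 'n\<close> and \<open>'n \<times> 'n \<times> 'n\<close>.
  The entries lie in an arbitrary unital ring, because they are complex numbers for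
  \<open>R\<close>, \<open>F\<close>, and noncommuting variables for the generating matrix \<open>M\<close>.
\<close>

type_synonym ('a, 'n) op1 = "'a ^ 'n ^ 'n"
type_synonym ('a, 'n) op2 = "'a ^ ('n \<times> 'n) ^ ('n \<times> 'n)"
type_synonym ('a, 'n) op3 = "'a ^ ('n \<times> 'n \<times> 'n) ^ ('n \<times> 'n \<times> 'n)"

definition on1 :: "('a::semiring_1, 'n::finite) op1 \<Rightarrow> ('a, 'n) op2" where
  "on1 Y = vec_lambda (\<lambda>(a, b). vec_lambda (\<lambda>(a', b'). if b = b' then Y $ a $ a' else 0))"

definition on2 :: "('a::semiring_1, 'n::finite) op1 \<Rightarrow> ('a, 'n) op2" where
  "on2 Y = vec_lambda (\<lambda>(a, b). vec_lambda (\<lambda>(a', b'). if a = a' then Y $ b $ b' else 0))"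

definition on12 :: "('a::semiring_1, 'n::finite) op2 \<Rightarrow> ('a, 'n) op3" where
  "on12 X = vec_lambda (\<lambda>(a, b, c). vec_lambda (\<lambda>(a', b', c').
     if c = c' then X $ (a, b) $ (a', b') else 0))"

definition on23 :: "('a::semiring_1, 'n::finite) op2 \<Rightarrow> ('a, 'n) op3" where
  "on23 X = vec_lambda (\<lambda>(a, b, c). vec_lambda (\<lambda>(a', b', c').
     if a = a' then X $ (b, c) $ (b', c') else 0))"

definition flip :: "(complex, 'n::finite) op2" where
  "flip = vec_lambda (\<lambda>(a, b). vec_lambda (\<lambda>(a', b'). if a = b' \<and> b = a' then 1 else 0))"

text \<open>
  Partial traces: \<open>tr1of2\<close> and \<open>tr2of2\<close> trace an operator on \<open>V \<otimes> V\<close> over the first and the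
  second factor; \<open>tr2of3\<close> traces an operator on \<open>V \<otimes> V \<otimes> V\<close> over the middle factor, the result
  acting on factors 1 and 3; \<open>tr23of3\<close> traces over factors 2 and 3.
\<close>

definition tr1of2 :: "('a::semiring_1, 'n::finite) op2 \<Rightarrow> ('a, 'n) op1" where
  "tr1of2 X = (\<chi> b b'. \<Sum>a\<in>UNIV. X $ (a, b) $ (a, b'))"

definition tr2of2 :: "('a::semiring_1, 'n::finite) op2 \<Rightarrow> ('a, 'n) op1" where
  "tr2of2 X = (\<chi> a a'. \<Sum>b\<in>UNIV. X $ (a, b) $ (a', b))"

definition tr2of3 :: "('a::semiring_1, 'n::finite) op3 \<Rightarrow> ('a, 'n) op2" where
  "tr2of3 X = vec_lambda (\<lambda>(a, c). vec_lambda (\<lambda>(a', c').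
     \<Sum>b\<in>UNIV. X $ (a, b, c) $ (a', b, c')))"

definition tr23of3 :: "('a::semiring_1, 'n::finite) op3 \<Rightarrow> ('a, 'n) op1" where
  "tr23of3 X = (\<chi> a a'. \<Sum>b\<in>UNIV. \<Sum>c\<in>UNIV. X $ (a, b, c) $ (a', b, c))"

section \<open>R-matrices\<close>

definition is_R_matrix :: "(complex, 'n::finite) op2 \<Rightarrow> bool" where
  "is_R_matrix R \<longleftrightarrow> invertible R \<and>
     on12 R ** on23 R ** on12 R = on23 R ** on12 R ** on23 R"

definition compatible_pair :: "(complex, 'n::finite) op2 \<Rightarrow> (complex, 'n) op2 \<Rightarrow> bool" where
  "compatible_pair R F \<longleftrightarrow>
     on12 R ** on23 F ** on12 F = on23 F ** on12 F ** on23 R \<and>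
     on23 R ** on12 F ** on23 F = on12 F ** on23 F ** on12 R"

definition is_skew_inverse :: "(complex, 'n::finite) op2 \<Rightarrow> (complex, 'n) op2 \<Rightarrow> bool" where
  "is_skew_inverse X \<Psi> \<longleftrightarrow>
     tr2of3 (on12 X ** on23 \<Psi>) = flip \<and> tr2of3 (on12 \<Psi> ** on23 X) = flip"

definition skew_invertible :: "(complex, 'n::finite) op2 \<Rightarrow> bool" where
  "skew_invertible X \<longleftrightarrow> (\<exists>\<Psi>. is_skew_inverse X \<Psi>)"

text \<open>The skew inverse is unique when it exists, so the choice operator selects it.\<close>

definition skew_inverse :: "(complex, 'n::finite) op2 \<Rightarrow> (complex, 'n) op2" where
  "skew_inverse X = (SOME \<Psi>. is_skew_inverse X \<Psi>)"

definition C_op :: "(complex, 'n::finite) op2 \<Rightarrow> (complex, 'n) op1" where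
  "C_op X = tr1of2 (skew_inverse X)"

definition D_op :: "(complex, 'n::finite) op2 \<Rightarrow> (complex, 'n) op1" where
  "D_op X = tr2of2 (skew_inverse X)"

definition strict_skew_invertible :: "(complex, 'n::finite) op2 \<Rightarrow> bool" where
  "strict_skew_invertible X \<longleftrightarrow>
     skew_invertible X \<and> (invertible (C_op X) \<or> invertible (D_op X))"

section \<open>BMW-type\<close>

text \<open>The ring multiplication and powers of type \<open>_ ^ _\<close> are componentwise, hence the explicit
  iteration of \<open>**\<close>; \<open>mat c\<close> is \<open>c\<close> times the identity.\<close>

definition matrix_poly :: "complex poly \<Rightarrow> complex ^ 'm ^ 'm::finite \<Rightarrow> complex ^ 'm ^ 'm" where
  "matrix_poly p X = (\<Sum>i\<le>degree p. mat (coeff p i) ** (((**) X ^^ i) (mat 1)))"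

definition is_minimal_poly :: "complex poly \<Rightarrow> complex ^ 'm ^ 'm::finite \<Rightarrow> bool" where
  "is_minimal_poly p X \<longleftrightarrow> lead_coeff p = 1 \<and> matrix_poly p X = 0 \<and>
     (\<forall>r. r \<noteq> 0 \<longrightarrow> matrix_poly r X = 0 \<longrightarrow> degree p \<le> degree r)"

definition K_op :: "complex \<Rightarrow> complex \<Rightarrow> (complex, 'n::finite) op2 \<Rightarrow> (complex, 'n) op2" where
  "K_op q \<mu> R =
     mat (inverse \<mu> * inverse (q - inverse q)) ** (mat q - R) ** (mat (inverse q) + R)"

text \<open>\<open>[:- q, 1:] * [:inverse q, 1:] * [:- \<mu>, 1:]\<close> is \<open>(x - q) (x + q\<^sup>-\<^sup>1) (x - \<mu>)\<close>, which agrees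
  with \<open>(q - x) (q\<^sup>-\<^sup>1 + x) (\<mu> - x)\<close>.\<close>

definition is_BMW_type :: "complex \<Rightarrow> complex \<Rightarrow> (complex, 'n::finite) op2 \<Rightarrow> bool" where
  "is_BMW_type q \<mu> R \<longleftrightarrow>
     is_R_matrix R \<and>
     is_minimal_poly ([:- q, 1:] * [:inverse q, 1:] * [:- \<mu>, 1:]) R \<and>
     (let K1 = on12 (K_op q \<mu> R); K2 = on23 (K_op q \<mu> R);
          R1 = on12 R; R2 = on23 R; R1' = on12 (matrix_inv R); R2' = on23 (matrix_inv R)
      in K2 ** K1 = R1 ** R2 ** K1 \<and> K2 ** K1 = R1' ** R2' ** K1 \<and> K1 ** K2 ** K1 = K1)"

definition eta :: "complex \<Rightarrow> complex \<Rightarrow> complex" where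
  "eta q \<mu> = (q - \<mu>) * (inverse q + \<mu>) / (\<mu> * (q - inverse q))"

definition G_op :: "complex \<Rightarrow> complex \<Rightarrow> (complex, 'n::finite) op2 \<Rightarrow> (complex, 'n) op2
    \<Rightarrow> (complex, 'n) op1" where
  "G_op q \<mu> R F =
     tr23of3 (on23 (K_op q \<mu> R) ** on12 (matrix_inv F) ** on23 (matrix_inv F))"

section \<open>Free algebras and presentations\<close>

text \<open>
  Words over \<open>'g\<close> under concatenation, written additively: \<open>poly_mapping\<close> carries the
  convolution product over an additive (not necessarily commutative) monoid of exponents, so
  \<open>'g word \<Rightarrow>\<^sub>0 complex\<close> is the free unital associative algebra on \<open>'g\<close>.
\<close>

datatype 'g word = Word (letters: "'g list")

instantiation word :: (type) monoid_add
begin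

definition zero_word :: "'g word" where "zero_word = Word []"

definition plus_word :: "'g word \<Rightarrow> 'g word \<Rightarrow> 'g word" where
  "plus_word u v = Word (letters u @ letters v)"

instance by standard (simp_all add: zero_word_def plus_word_def)

end

type_synonym 'g free_alg = "'g word \<Rightarrow>\<^sub>0 complex"

definition free_gen :: "'g \<Rightarrow> 'g free_alg" where
  "free_gen x = Poly_Mapping.single (Word [x]) 1"

definition free_const :: "complex \<Rightarrow> 'g free_alg" where
  "free_const c = Poly_Mapping.single 0 c"

definition free_const_mat :: "complex ^ 'm ^ 'k \<Rightarrow> 'g free_alg ^ 'm ^ 'k" where
  "free_const_mat X = (\<chi> i j. free_const (X $ i $ j))"

definition free_alg_ring :: "'g free_alg ring" where
  "free_alg_ring = \<lparr>carrier = UNIV, mult = (*), one = 1, zero = 0, add = (+)\<rparr>"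

definition presented_alg :: "'g free_alg set \<Rightarrow> 'g free_alg set ring" where
  "presented_alg S = free_alg_ring Quot (Idl\<^bsub>free_alg_ring\<^esub> S)"

definition presented_class :: "'g free_alg set \<Rightarrow> 'g free_alg \<Rightarrow> 'g free_alg set" where
  "presented_class S x = (Idl\<^bsub>free_alg_ring\<^esub> S) +>\<^bsub>free_alg_ring\<^esub> x"

definition presented_class_mat ::
    "'g free_alg set \<Rightarrow> 'g free_alg ^ 'm ^ 'k \<Rightarrow> 'g free_alg set ^ 'm ^ 'k" where
  "presented_class_mat S X = (\<chi> i j. presented_class S (X $ i $ j))"

definition ring_mat_mult :: "('a, 'b) ring_scheme \<Rightarrow> 'a ^ 'm ^ 'k \<Rightarrow> 'a ^ 'l ^ 'm::finite
    \<Rightarrow> 'a ^ 'l ^ 'k" where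
  "ring_mat_mult A X Y = (\<chi> i j. \<Oplus>\<^bsub>A\<^esub>k\<in>UNIV. X $ i $ k \<otimes>\<^bsub>A\<^esub> Y $ k $ j)"

definition ring_mat_one :: "('a, 'b) ring_scheme \<Rightarrow> 'a ^ 'm ^ 'm" where
  "ring_mat_one A = (\<chi> i j. if i = j then \<one>\<^bsub>A\<^esub> else \<zero>\<^bsub>A\<^esub>)"

section \<open>The quantum matrix algebra and its extension\<close>

text \<open>
  Everything below is built from a matrix over a free algebra; its image in a
  presented algebra is taken entrywise.
  \<open>M_bar1\<close> and \<open>M_bar2\<close> act on \<open>V \<otimes> V\<close>.
\<close>

definition M_bar1 :: "('g free_alg, 'n::finite) op1 \<Rightarrow> ('g free_alg, 'n) op2" where
  "M_bar1 M = on1 M"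

definition M_bar2 :: "(complex, 'n::finite) op2 \<Rightarrow> ('g free_alg, 'n) op1
    \<Rightarrow> ('g free_alg, 'n) op2" where
  "M_bar2 F M = free_const_mat F ** M_bar1 M ** free_const_mat (matrix_inv F)"

definition qma_relators :: "(complex, 'n::finite) op2 \<Rightarrow> (complex, 'n) op2
    \<Rightarrow> ('g free_alg, 'n) op1 \<Rightarrow> 'g free_alg set" where
  "qma_relators R F M =
     {(free_const_mat R ** M_bar1 M ** M_bar2 F M
        - M_bar1 M ** M_bar2 F M ** free_const_mat R) $ i $ j | i j. True}"

definition two_contraction :: "complex \<Rightarrow> complex \<Rightarrow> (complex, 'n::finite) op2
    \<Rightarrow> (complex, 'n) op2 \<Rightarrow> ('g free_alg, 'n) op1 \<Rightarrow> 'g free_alg" where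
  "two_contraction q \<mu> R F M =
     free_const (inverse (eta q \<mu>)) *
       trace (free_const_mat (on1 (D_op R)) ** free_const_mat (on2 (D_op R))
         ** (M_bar1 M ** M_bar2 F M ** free_const_mat (K_op q \<mu> R)))"

definition xi :: "complex \<Rightarrow> complex \<Rightarrow> (complex, 'n::finite) op2
    \<Rightarrow> (complex, 'n) op2 \<Rightarrow> ('g free_alg, 'n) op1 \<Rightarrow> ('g free_alg, 'n) op1" where
  "xi q \<mu> R F Y =
     tr2of2 (free_const_mat (on2 (D_op R))
       ** (free_const_mat F ** on1 Y ** free_const_mat (matrix_inv F)
           ** free_const_mat (K_op q \<mu> R)))"

text \<open>
  \<open>M(R,F)\<close> extended by \<open>g\<^sup>-\<^sup>1\<close> is presented by the generators \<open>M_a\<^sup>b\<close> (here \<open>Entry a b\<close>, row \<open>a\<close>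
  and column \<open>b\<close> of \<open>M\<close>) and \<open>g\<^sup>-\<^sup>1\<close> (here \<open>GInv\<close>), subject to the relations of \<open>M(R,F)\<close>
  together with those involving \<open>g\<^sup>-\<^sup>1\<close>.
\<close>

datatype 'n qma_gen = Entry 'n 'n | GInv

definition M_gen :: "('n qma_gen free_alg, 'n::finite) op1" where
  "M_gen = (\<chi> a b. free_gen (Entry a b))"

definition g_inv :: "'n qma_gen free_alg" where
  "g_inv = free_gen GInv"

definition ext_relators :: "complex \<Rightarrow> complex \<Rightarrow> (complex, 'n::finite) op2
    \<Rightarrow> (complex, 'n) op2 \<Rightarrow> 'n qma_gen free_alg set" where
  "ext_relators q \<mu> R F =
     (let g = two_contraction q \<mu> R F M_gen;
          G = free_const_mat (G_op q \<mu> R F);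
          G' = free_const_mat (matrix_inv (G_op q \<mu> R F))
      in qma_relators R F M_gen
         \<union> {g_inv * g - 1, g * g_inv - 1}
         \<union> {g_inv * M_gen $ a $ b - (G' ** M_gen ** G) $ a $ b * g_inv | a b. True})"

definition qma_ext :: "complex \<Rightarrow> complex \<Rightarrow> (complex, 'n::finite) op2
    \<Rightarrow> (complex, 'n) op2 \<Rightarrow> 'n qma_gen free_alg set ring" where
  "qma_ext q \<mu> R F = presented_alg (ext_relators q \<mu> R F)"

definition qma_M :: "complex \<Rightarrow> complex \<Rightarrow> (complex, 'n::finite) op2
    \<Rightarrow> (complex, 'n) op2 \<Rightarrow> ('n qma_gen free_alg set, 'n) op1" where
  "qma_M q \<mu> R F = presented_class_mat (ext_relators q \<mu> R F) M_gen"

definition qma_M_inv :: "complex \<Rightarrow> complex \<Rightarrow> (complex, 'n::finite) op2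
    \<Rightarrow> (complex, 'n) op2 \<Rightarrow> ('n qma_gen free_alg set, 'n) op1" where
  "qma_M_inv q \<mu> R F = presented_class_mat (ext_relators q \<mu> R F)
     (\<chi> a b. free_const \<mu> * xi q \<mu> R F M_gen $ a $ b * g_inv)"

end

theory Submission
  imports Defs
begin

text \<open>
  Sandwiching \<open>R\<close> between two copies of \<open>K\<close> and contracting with the skew inverse shows that \<open>K\<close> has
  rank one, \<open>K = u \<otimes> v\<close>, where \<open>u\<close> and \<open>v\<close> are nondegenerate bilinear tensors with matrices \<open>U\<close> and
  \<open>V\<close>, and that \<open>D\<^sub>R = \<mu> U V\<^sup>T\<close>.  Modulo the relations, \<open>X = M\<^sub>1 M\<^sub>2\<close> (the second factor being the
  \<open>F\<close>-conjugated one) commutes with \<open>K\<close>, so that \<open>v X = \<gamma> v\<close> and \<open>X K = \<gamma> K\<close> for a single element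
  \<open>\<gamma>\<close>.  Taking R-traces of \<open>X K = \<gamma> K\<close> gives \<open>g = \<mu>\<^sup>2 \<gamma>\<close> and \<open>M \<cdot> \<xi>(M) = \<mu> \<gamma>\<close>, so the proposed matrix is a
  right inverse.  Multiplying \<open>v X = \<gamma> v\<close> by \<open>F\<close> gives \<open>v M\<^sub>1 F M\<^sub>1 = \<gamma> (v F)\<close>; the bilinear form \<open>v F\<close>
  is nondegenerate, hence \<open>M\<close> also has some left inverse, and the two inverses agree.
\<close>

section \<open>Matrices over noncommutative rings\<close>

lemma mat_mult_nth [simp]: "(mat c ** A) $ i $ j = c * A $ i $ j"
  by (simp add: matrix_matrix_mult_def mat_def if_distrib if_distribR cong: if_cong)

lemma mult_mat_nth [simp]: "(A ** mat c) $ i $ j = A $ i $ j * c"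
  by (simp add: matrix_matrix_mult_def mat_def if_distrib if_distribR cong: if_cong)

lemma mat_nth: "mat c $ i $ j = (if i = j then c else 0)"
  by (simp add: mat_def)

lemma matrix_mult_nth: "(A ** B) $ i $ j = (\<Sum>k\<in>UNIV. A $ i $ k * B $ k $ j)"
  by (simp add: matrix_matrix_mult_def)

lemma mat_mult_commute:
  fixes A :: "'a::comm_semiring_1 ^ 'm::finite ^ 'm"
  shows "A ** mat c = mat c ** A"
  by (simp add: vec_eq_iff mult.commute)

lemma matrix_add_rdistrib: "(A + B) ** C = A ** C + B ** C"
  by (simp add: vec_eq_iff matrix_mult_nth distrib_right sum.distrib)

lemma matrix_diff_ldistrib:
  fixes A :: "'a::ring_1 ^ 'm::finite ^ 'k"
  shows "A ** (B - C) = A ** B - A ** C"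
  by (simp add: vec_eq_iff matrix_mult_nth right_diff_distrib sum_subtractf)

lemma matrix_diff_rdistrib:
  fixes A :: "'a::ring_1 ^ 'm::finite ^ 'k"
  shows "(A - B) ** C = A ** C - B ** C"
  by (simp add: vec_eq_iff matrix_mult_nth left_diff_distrib sum_subtractf)

lemmas matrix_distribs = matrix_add_ldistrib matrix_add_rdistrib
  matrix_diff_ldistrib matrix_diff_rdistrib

lemma matrix_inv_mult:
  assumes "invertible A"
  shows "A ** matrix_inv A = mat 1" "matrix_inv A ** A = mat 1"
  using assms unfolding invertible_def matrix_inv_def by (metis (mono_tags, lifting) someI_ex)+

lemma invertible_factor:
  fixes A B :: "'a::field ^ 'n::finite ^ 'n"
  assumes "invertible (A ** B)"
  shows "invertible A" "invertible B"
  using assms matrix_mul_assoc unfolding invertible_right_inverse by (metis,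
    metis invertible_left_inverse invertible_right_inverse matrix_mul_assoc)

lemma invertible_transpose:
  fixes A :: "'a::field ^ 'n::finite ^ 'n"
  assumes "invertible A"
  shows "invertible (transpose A)"
  using assms unfolding invertible_def by (metis matrix_transpose_mul transpose_mat)

lemma invertible_scale:
  fixes A :: "'a::field ^ 'n::finite ^ 'n"
  assumes "invertible A" "c \<noteq> 0"
  shows "invertible (mat c ** A)"
proof -
  have "mat (inverse c) ** mat c = (mat 1 :: 'a ^ 'n ^ 'n)"
    using \<open>c \<noteq> 0\<close> by (simp add: vec_eq_iff mat_nth)
  then have "invertible (mat c :: 'a ^ 'n ^ 'n)"
    by (auto simp: invertible_left_inverse)
  then show ?thesis
    using assms(1) by (rule invertible_mult)
qed

lemma matrix_mult_left_cancel:
  assumes "invertible A" "A ** B = A ** C"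
  shows "B = C"
  using assms by (metis matrix_inv_mult(2) matrix_mul_assoc matrix_mul_lid)

lemma sum_UNIV_prod: "(\<Sum>x\<in>UNIV. f x) = (\<Sum>a\<in>UNIV. \<Sum>b\<in>UNIV. f (a, b))"
  for f :: "'a::finite \<times> 'b::finite \<Rightarrow> 'c::comm_monoid_add"
  by (simp add: sum.cartesian_product flip: UNIV_Times_UNIV)

lemma mult_if_zero:
  "x * (if P then y else 0) = (if P then x * y else 0)"
  "(if P then y else 0) * x = (if P then y * x else 0)"
  for x y :: "'a::mult_zero"
  by auto

lemma sum_if_zero: "(\<Sum>k\<in>A. if P then f k else 0) = (if P then \<Sum>k\<in>A. f k else 0)"
  by auto

section \<open>Operators on tensor powers\<close>

lemma on1_nth [simp]: "on1 Y $ (a, b) $ (a', b') = (if b = b' then Y $ a $ a' else 0)"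
  and on2_nth [simp]: "on2 Y $ (a, b) $ (a', b') = (if a = a' then Y $ b $ b' else 0)"
  and on12_nth [simp]:
    "on12 X $ (a, b, c) $ (a', b', c') = (if c = c' then X $ (a, b) $ (a', b') else 0)"
  and on23_nth [simp]:
    "on23 X $ (a, b, c) $ (a', b', c') = (if a = a' then X $ (b, c) $ (b', c') else 0)"
  and flip_nth [simp]: "flip $ (a, b) $ (a', b') = (if a = b' \<and> b = a' then 1 else 0)"
  and tr1of2_nth [simp]: "tr1of2 X $ b $ b' = (\<Sum>a\<in>UNIV. X $ (a, b) $ (a, b'))"
  and tr2of2_nth [simp]: "tr2of2 X $ a $ a' = (\<Sum>b\<in>UNIV. X $ (a, b) $ (a', b))"
  and tr2of3_nth [simp]:
    "tr2of3 Z $ (a, c) $ (a', c') = (\<Sum>b\<in>UNIV. Z $ (a, b, c) $ (a', b, c'))"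
  by (simp_all add: on1_def on2_def on12_def on23_def flip_def tr1of2_def tr2of2_def tr2of3_def)

lemma on12_mult: "on12 (A ** B) = on12 A ** on12 B"
  by (simp add: vec_eq_iff split_paired_all matrix_mult_nth sum_UNIV_prod mult_if_zero
      sum_if_zero cong: if_cong)

lemma on23_mult: "on23 (A ** B) = on23 A ** on23 B"
  by (simp add: vec_eq_iff split_paired_all matrix_mult_nth sum_UNIV_prod mult_if_zero
      sum_if_zero cong: if_cong)

lemma on12_mat [simp]: "on12 (mat c) = mat c"
  and on23_mat [simp]: "on23 (mat c) = mat c"
  by (auto simp add: vec_eq_iff split_paired_all mat_nth)

lemma on12_add: "on12 (A + B) = on12 A + on12 B"
  and on23_add: "on23 (A + B) = on23 A + on23 B"
  by (auto simp add: vec_eq_iff split_paired_all)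

lemma on12_diff: "on12 (A - B) = on12 A - on12 B"
  and on23_diff: "on23 (A - B) = on23 A - on23 B" for A :: "('a::ring_1, 'n::finite) op2"
  by (auto simp add: vec_eq_iff split_paired_all)

text \<open>\<open>B\<close> does not depend on \<open>s\<close>, so with this order of summation
  the outer factors \<open>A\<close> and \<open>C\<close> merge into one coefficient array in
  \<open>t\<close>, \<open>t'\<close> contracted with \<open>B\<close>. The skew inverse can undo
  such a contraction.\<close>

lemma on12_on23_on12_nth:
  fixes A B C :: "('a::semiring_1, 'n::finite) op2"
  shows "(on12 A ** on23 B ** on12 C) $ (a, b, c) $ (a', b', c') =
    (\<Sum>t\<in>UNIV. \<Sum>t'\<in>UNIV. \<Sum>s\<in>UNIV. A $ (a, b) $ (s, t) * B $ (t, c) $ (t', c') * C $ (s, t') $ (a', b'))"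
proof -
  have "(on12 A ** on23 B ** on12 C) $ (a, b, c) $ (a', b', c') =
    (\<Sum>s\<in>UNIV. \<Sum>t'\<in>UNIV. \<Sum>t\<in>UNIV. A $ (a, b) $ (s, t) * B $ (t, c) $ (t', c') * C $ (s, t') $ (a', b'))"
    by (simp add: matrix_mult_nth sum_UNIV_prod mult_if_zero sum_distrib_right
      sum_if_zero cong: if_cong)
  also have "\<dots> = (\<Sum>t'\<in>UNIV. \<Sum>t\<in>UNIV. \<Sum>s\<in>UNIV. A $ (a, b) $ (s, t) * B $ (t, c) $ (t', c') * C $ (s, t') $ (a', b'))"
    by (rule trans[OF sum.swap]) (rule sum.cong[OF refl sum.swap])
  finally show ?thesis by (rule trans[OF _ sum.swap])
qed

lemma on23_on12_on23_nth:
  fixes A B C :: "('a::semiring_1, 'n::finite) op2"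
  shows "(on23 A ** on12 B ** on23 C) $ (a, b, c) $ (a', b', c') =
    (\<Sum>s\<in>UNIV. \<Sum>s'\<in>UNIV. \<Sum>t\<in>UNIV. A $ (b, c) $ (s, t) * B $ (a, s) $ (a', s') * C $ (s', t) $ (b', c'))"
proof -
  have "(on23 A ** on12 B ** on23 C) $ (a, b, c) $ (a', b', c') =
    (\<Sum>s'\<in>UNIV. \<Sum>t\<in>UNIV. \<Sum>s\<in>UNIV. A $ (b, c) $ (s, t) * B $ (a, s) $ (a', s') * C $ (s', t) $ (b', c'))"
    by (simp add: matrix_mult_nth sum_UNIV_prod mult_if_zero sum_distrib_right
      sum_if_zero cong: if_cong)
  also have "\<dots> = (\<Sum>s'\<in>UNIV. \<Sum>s\<in>UNIV. \<Sum>t\<in>UNIV. A $ (b, c) $ (s, t) * B $ (a, s) $ (a', s') * C $ (s', t) $ (b', c'))"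
    by (rule sum.cong[OF refl sum.swap])
  finally show ?thesis by (rule trans[OF _ sum.swap])
qed

lemma skew_inverse_nth:
  assumes "is_skew_inverse X \<Psi>"
  shows "(\<Sum>b\<in>UNIV. \<Sum>m\<in>UNIV. X $ (a, b) $ (a', m) * \<Psi> $ (m, c) $ (b, c')) =
      (if a = c' \<and> c = a' then 1 else 0)"
    and "(\<Sum>b\<in>UNIV. \<Sum>m\<in>UNIV. \<Psi> $ (a, b) $ (a', m) * X $ (m, c) $ (b, c')) =
      (if a = c' \<and> c = a' then 1 else 0)"
proof -
  have "tr2of3 (on12 X ** on23 \<Psi>) $ (a, c) $ (a', c') = flip $ (a, c) $ (a', c')"
    "tr2of3 (on12 \<Psi> ** on23 X) $ (a, c) $ (a', c') = flip $ (a, c) $ (a', c')"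
    using assms unfolding is_skew_inverse_def by auto
  then show "(\<Sum>b\<in>UNIV. \<Sum>m\<in>UNIV. X $ (a, b) $ (a', m) * \<Psi> $ (m, c) $ (b, c')) =
      (if a = c' \<and> c = a' then 1 else 0)"
    and "(\<Sum>b\<in>UNIV. \<Sum>m\<in>UNIV. \<Psi> $ (a, b) $ (a', m) * X $ (m, c) $ (b, c')) =
      (if a = c' \<and> c = a' then 1 else 0)"
    by (simp_all add: matrix_mult_nth sum_UNIV_prod mult_if_zero sum_if_zero cong: if_cong)
qed

section \<open>The operator \<open>K\<close>\<close>

lemma matrix_poly_cubic:
  assumes "degree p \<le> 3"
  shows "matrix_poly p X = mat (coeff p 0) + mat (coeff p 1) ** X + mat (coeff p 2) ** (X ** X)
    + mat (coeff p 3) ** (X ** (X ** X))"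
proof -
  have "matrix_poly p X = (\<Sum>i\<le>3. mat (coeff p i) ** (((**) X ^^ i) (mat 1)))"
    unfolding matrix_poly_def using assms
    by (intro sum.mono_neutral_left) (auto simp: coeff_eq_0)
  also have "{..3} = {0,1,2,3::nat}" by auto
  finally show ?thesis
    by (simp add: numeral_2_eq_2 numeral_3_eq_3 add.assoc)
qed

lemma mult_mat_mult: "A ** (mat c ** B) = mat c ** (A ** B)"
  for A :: "'a::comm_semiring_1 ^ 'm::finite ^ 'm"
  by (simp add: matrix_mul_assoc mat_mult_commute)

lemma mat_mult_mat: "mat c ** mat d = mat (c * d)"
  by (simp add: vec_eq_iff mat_nth)

lemma matrix_mult_reassoc: "A ** B = C \<Longrightarrow> A ** (B ** X) = C ** X"
  by (simp add: matrix_mul_assoc)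

lemma intertwine_inverse:
  assumes "Z ** Y = mat 1" "Y ** Z = mat 1" "Y ** B = A ** Y"
  shows "Z ** A = B ** Z"
proof -
  have "Z ** A = Z ** (A ** Y) ** Z"
    using assms(2) by (simp flip: matrix_mul_assoc)
  also have "\<dots> = Z ** (Y ** B) ** Z"
    by (simp only: assms(3))
  finally show ?thesis
    using assms(1) by (simp add: matrix_mul_assoc)
qed

section \<open>Relations between \<open>K\<close> and \<open>R\<close> in the BMW case\<close>

locale BMW =
  fixes R :: "(complex, 'n::finite) op2" and q \<mu> :: complex
  assumes q: "q \<notin> {0, 1, - 1}" and mu: "\<mu> \<noteq> 0"
    and BMW: "is_BMW_type q \<mu> R"
begin

definition "K = K_op q \<mu> R"
definition "h = q - inverse q"

lemma q_nonzero: "q \<noteq> 0" and h_nonzero: "h \<noteq> 0"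
proof -
  show "q \<noteq> 0" using q by auto
  then have "h = 0 \<longleftrightarrow> q\<^sup>2 = 1"
    by (simp add: h_def field_simps power2_eq_square)
  then show "h \<noteq> 0" using q by (auto simp: power2_eq_1_iff)
qed

lemma R_inv: "R ** matrix_inv R = mat 1" "matrix_inv R ** R = mat 1"
  using BMW matrix_inv_mult by (auto simp: is_BMW_type_def is_R_matrix_def)

lemma braid: "on12 R ** on23 R ** on12 R = on23 R ** on12 R ** on23 R"
  using BMW by (simp add: is_BMW_type_def is_R_matrix_def)

lemma K21: "on23 K ** on12 K = on12 R ** on23 R ** on12 K"
    "on23 K ** on12 K = on12 (matrix_inv R) ** on23 (matrix_inv R) ** on12 K"
  and K121: "on12 K ** on23 K ** on12 K = on12 K"
  using BMW by (unfold is_BMW_type_def K_def Let_def) blast+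

text \<open>\<open>(q - R) (1/q + R) = 1 + h R - R R\<close>. As a polynomial in \<open>R\<close>,
  \<open>K\<close> inherits every commutation or intertwining property of \<open>R\<close>.\<close>

lemma K_eq: "K = mat (inverse (\<mu> * h)) + mat (inverse \<mu>) ** R - mat (inverse (\<mu> * h)) ** (R ** R)"
proof -
  have "K $ i $ j = (mat (inverse (\<mu> * h)) + mat (inverse \<mu>) ** R
      - mat (inverse (\<mu> * h)) ** (R ** R)) $ i $ j" for i j
  proof -
    have "K $ i $ j = inverse (\<mu> * h) * ((mat q - R) ** (mat (inverse q) + R)) $ i $ j"
      by (simp add: K_def K_op_def h_def flip: matrix_mul_assoc)
    also have "\<dots> = inverse (\<mu> * h) * (mat 1 $ i $ j + h * R $ i $ j - (R ** R) $ i $ j)"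
      using q_nonzero by (simp add: matrix_distribs mat_nth h_def algebra_simps)
    also have "\<dots> = (mat (inverse (\<mu> * h)) + mat (inverse \<mu>) ** R
      - mat (inverse (\<mu> * h)) ** (R ** R)) $ i $ j"
      using h_nonzero mu by (simp add: mat_nth field_simps)
    finally show ?thesis .
  qed
  then show ?thesis by (simp add: vec_eq_iff)
qed

text \<open>The annihilating cubic expands to
  \<open>x^3 - (\<mu> + h) x^2 + (h \<mu> - 1) x + \<mu>\<close>, because
  \<open>(x - q) (x + 1/q) = x^2 - h x - 1\<close>.\<close>

lemma R_cubic: "R ** (R ** R) = mat (\<mu> + h) ** (R ** R) + mat (1 - h * \<mu>) ** R - mat \<mu>"
proof -
  let ?p = "[:- q, 1:] * [:inverse q, 1:] * [:- \<mu>, 1:]"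
  have p: "?p = [:\<mu>, h * \<mu> - 1, - (\<mu> + h), 1:]"
    using q_nonzero by (simp add: h_def field_simps)
  have deg: "degree [:\<mu>, h * \<mu> - 1, - (\<mu> + h), 1:] \<le> 3" by simp
  have "matrix_poly ?p R = 0"
    using BMW by (simp add: is_BMW_type_def is_minimal_poly_def del: mult_pCons_left mult_pCons_right)
  then have *: "mat \<mu> + mat (h * \<mu> - 1) ** R + mat (- (\<mu> + h)) ** (R ** R) + R ** (R ** R) = 0"
    unfolding p matrix_poly_cubic[OF deg] by (simp add: numeral_2_eq_2 numeral_3_eq_3)
  have "(R ** (R ** R)) $ i $ j =
      (mat (\<mu> + h) ** (R ** R) + mat (1 - h * \<mu>) ** R - mat \<mu>) $ i $ j" for i j
  proof -
    from * have "(mat \<mu> + mat (h * \<mu> - 1) ** R + mat (- (\<mu> + h)) ** (R ** R)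
        + R ** (R ** R)) $ i $ j = 0"
      by simp
    then show ?thesis by (simp add: algebra_simps)
  qed
  then show ?thesis by (simp add: vec_eq_iff)
qed

text \<open>Here the minimality of the cubic enters: the quadratic \<open>?r\<close> takes the value
  \<open>K\<close> at \<open>R\<close>, so it cannot annihilate \<open>R\<close>.\<close>

lemma K_nonzero: "K \<noteq> 0"
proof
  assume "K = 0"
  let ?r = "[:inverse (\<mu> * h), inverse \<mu>, - inverse (\<mu> * h):]"
  have deg: "degree ?r \<le> 3" by simp
  have "matrix_poly ?r R = 0"
    using \<open>K = 0\<close> unfolding matrix_poly_cubic[OF deg] K_eq
    by (simp add: numeral_2_eq_2 numeral_3_eq_3 vec_eq_iff)
  moreover have "?r \<noteq> 0" "degree ?r = 2" using h_nonzero mu by auto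
  moreover have "degree ([:- q, 1:] * [:inverse q, 1:] * [:- \<mu>, 1:]) = 3"
    by (subst degree_mult_eq, simp, simp)+ simp
  ultimately show False
    using BMW unfolding is_BMW_type_def is_minimal_poly_def
    by (auto simp del: mult_pCons_left mult_pCons_right dest!: spec[of _ ?r])
qed

text \<open>\<open>K\<close> is a multiple of \<open>(q - R) (1/q + R)\<close>, so
  \<open>(\<mu> - R) K\<close> is a multiple of the cubic evaluated at \<open>R\<close>.\<close>

lemma R_K: "R ** K = mat \<mu> ** K"
proof -
  have "(R ** K) $ i $ j = (mat \<mu> ** K) $ i $ j" for i j
  proof -
    have "(R ** K) $ i $ j = inverse (\<mu> * h) * R $ i $ j + inverse \<mu> * (R ** R) $ i $ j
        - inverse (\<mu> * h) * (R ** (R ** R)) $ i $ j"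
      by (simp add: K_eq matrix_distribs mult_mat_mult)
    also have "\<dots> = (mat \<mu> ** K) $ i $ j"
      unfolding R_cubic using mu h_nonzero by (simp add: K_eq mat_nth field_simps)
    finally show ?thesis .
  qed
  then show ?thesis by (simp add: vec_eq_iff)
qed

lemma K_R: "K ** R = mat \<mu> ** K"
proof -
  have "K ** R = R ** K"
    by (simp add: K_eq matrix_distribs mult_mat_mult mat_mult_commute flip: matrix_mul_assoc)
  then show ?thesis by (simp add: R_K)
qed

text \<open>The skein relation: multiply the polynomial formula for \<open>K\<close> by the inverse
  of \<open>R\<close>, which \<open>K\<close> absorbs up to the factor \<open>\<mu>\<close>. It
  links the weighted traces of \<open>1\<close>, \<open>K\<close>, \<open>R\<close> and its inverse,
  and so determines the trace of \<open>U V^T\<close> later.\<close>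

lemma R_minus_inv: "R - matrix_inv R = mat h ** (mat 1 - K)"
proof -
  have "matrix_inv R ** (R ** K) = mat \<mu> ** (matrix_inv R ** K)"
    unfolding R_K by (metis mat_mult_commute matrix_mul_assoc)
  then have 1: "K = mat \<mu> ** (matrix_inv R ** K)"
    using R_inv by (simp add: matrix_mul_assoc)
  have "matrix_inv R ** K = mat (inverse (\<mu> * h)) ** matrix_inv R + mat (inverse \<mu>)
      - mat (inverse (\<mu> * h)) ** R"
    unfolding K_eq by (simp add: matrix_distribs mult_mat_mult R_inv mat_mult_commute[of "matrix_inv R"])
       (simp add: matrix_mul_assoc R_inv)
  with 1 have "K = mat \<mu> ** (mat (inverse (\<mu> * h)) ** matrix_inv R + mat (inverse \<mu>)
      - mat (inverse (\<mu> * h)) ** R)"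
    by simp
  then have 2: "K $ i $ j = \<mu> * (inverse (\<mu> * h) * matrix_inv R $ i $ j
      + mat (inverse \<mu>) $ i $ j - inverse (\<mu> * h) * R $ i $ j)" for i j
    by (simp only: mat_mult_nth vector_add_component vector_minus_component)
  have "h * K $ i $ j = h * mat 1 $ i $ j + matrix_inv R $ i $ j - R $ i $ j" for i j
    unfolding 2 by (use mu h_nonzero in \<open>simp add: mat_nth field_simps\<close>)
  then show ?thesis
    by (simp add: vec_eq_iff right_diff_distrib del: split_paired_All)
qed

lemma matrix_inv_R_K: "matrix_inv R ** K = mat (inverse \<mu>) ** K"
proof -
  have "mat \<mu> ** (matrix_inv R ** K) = K"
    by (metis R_K R_inv(2) matrix_mul_assoc matrix_mul_lid mult_mat_mult)
  then show ?thesis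
    using mu by (metis (no_types, lifting) matrix_mul_assoc matrix_mul_lid mat_mult_mat left_inverse)
qed

lemma intertwine_K:
  assumes "Z ** on12 R = on23 R ** Z"
  shows "Z ** on12 K = on23 K ** Z"
proof -
  have "Z ** (on12 R ** on12 R) = on23 R ** (on23 R ** Z)"
    using assms by (metis matrix_mul_assoc)
  then show ?thesis using assms
    by (simp add: K_eq on12_add on12_diff on12_mult on23_add on23_diff on23_mult
        matrix_distribs mult_mat_mult mat_mult_commute[of Z] flip: matrix_mul_assoc)
qed

text \<open>By the braid relation \<open>R1 R2\<close> intertwines \<open>R1\<close> with
  \<open>R2\<close>, hence \<open>K1\<close> with \<open>K2\<close>. This moves \<open>K\<close> to
  the left end of the axiom \<open>K21\<close>.\<close>

lemma K2_R1_R2: "on23 K ** on12 K = on23 K ** (on12 R ** on23 R)"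
  using intertwine_K[of "on12 R ** on23 R"] K21(1) braid by (simp add: matrix_mul_assoc)

text \<open>Same argument for \<open>?Z\<close>, the inverse of \<open>R2 R1\<close>; the braid
  relation for \<open>R2 R1\<close> is turned around by \<open>intertwine_inverse\<close>.\<close>

lemma K2_R1_R2_inv: "on23 K ** on12 K = on23 K ** (on12 (matrix_inv R) ** on23 (matrix_inv R))"
proof -
  let ?Z = "on12 (matrix_inv R) ** on23 (matrix_inv R)"
  have inv: "on12 (matrix_inv R) ** on12 R = mat 1" "on12 R ** on12 (matrix_inv R) = mat 1"
    "on23 (matrix_inv R) ** on23 R = mat 1" "on23 R ** on23 (matrix_inv R) = mat 1"
    using R_inv by (simp_all flip: on12_mult on23_mult)
  have "?Z ** (on23 R ** on12 R) = mat 1" "(on23 R ** on12 R) ** ?Z = mat 1"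
    by (simp_all add: matrix_mult_reassoc[OF inv(1)] matrix_mult_reassoc[OF inv(2)]
        matrix_mult_reassoc[OF inv(3)] matrix_mult_reassoc[OF inv(4)] inv flip: matrix_mul_assoc)
  moreover have "on23 R ** on12 R ** on23 R = on12 R ** (on23 R ** on12 R)"
    by (simp add: matrix_mul_assoc braid)
  ultimately have "?Z ** on12 R = on23 R ** ?Z"
    by (rule intertwine_inverse)
  then show ?thesis
    using K21(2) intertwine_K[of ?Z] by simp
qed

text \<open>With \<open>Z = R1 R2\<close> one has
  \<open>K2 Z = Z K1 = Z K1 K2 K1 = K2 K1 K2 Z\<close>, and \<open>Z\<close> can be
  cancelled.\<close>

lemma K212: "on23 K ** on12 K ** on23 K = on23 K"
proof -
  let ?Z = "on12 R ** on23 R" and ?Z' = "on23 (matrix_inv R) ** on12 (matrix_inv R)"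
  have inv: "on12 R ** on12 (matrix_inv R) = mat 1" "on23 R ** on23 (matrix_inv R) = mat 1"
    using R_inv by (simp_all flip: on12_mult on23_mult)
  have ZZ': "?Z ** ?Z' = mat 1"
    by (simp add: matrix_mult_reassoc[OF inv(2)] inv flip: matrix_mul_assoc)
  have "on23 K ** ?Z = ?Z ** (on12 K ** on23 K ** on12 K)"
    using K21(1) K121 K2_R1_R2 by simp
  also have "\<dots> = (?Z ** on12 K) ** (on23 K ** on12 K)"
    by (simp add: matrix_mul_assoc)
  also have "\<dots> = (on23 K ** on12 K) ** (on23 K ** ?Z)"
    by (simp only: K21(1)[symmetric] K2_R1_R2[symmetric])
  finally have "on23 K ** (?Z ** ?Z') = on23 K ** on12 K ** on23 K ** (?Z ** ?Z')"
    by (simp add: matrix_mul_assoc)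
  then show ?thesis by (simp add: ZZ')
qed

lemma mat_mult_eq_iff: "mat \<mu> ** A = B \<longleftrightarrow> A = mat (inverse \<mu>) ** B"
  using mu by (auto simp: matrix_mul_assoc mat_mult_mat)

text \<open>In \<open>K1 = K1 K2 K1 = K1 R1 R2 K1\<close> the factor \<open>R1\<close> is absorbed
  by the left \<open>K1\<close> at the cost of \<open>\<mu>\<close>. The next two lemmas absorb the
  outer factor on the right in the same way.\<close>

lemma K1_R2_K1: "on12 K ** on23 R ** on12 K = mat (inverse \<mu>) ** on12 K"
proof -
  have "on12 K = on12 (K ** R) ** on23 R ** on12 K"
    using K121 K21(1) by (simp add: on12_mult flip: matrix_mul_assoc)
  then have "mat \<mu> ** (on12 K ** on23 R ** on12 K) = on12 K"
    by (simp add: K_R on12_mult matrix_mul_assoc)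
  then show ?thesis by (simp add: mat_mult_eq_iff)
qed

lemma K2_R1_K2: "on23 K ** on12 R ** on23 K = mat (inverse \<mu>) ** on23 K"
proof -
  have "on23 K = on23 K ** on12 R ** on23 (R ** K)"
    using K212 by (simp add: K2_R1_R2 on23_mult matrix_mul_assoc)
  then have "mat \<mu> ** (on23 K ** on12 R ** on23 K) = on23 K"
    by (simp add: R_K on23_mult mult_mat_mult)
  then show ?thesis by (simp add: mat_mult_eq_iff)
qed

lemma K2_inv_R1_K2: "on23 K ** on12 (matrix_inv R) ** on23 K = mat \<mu> ** on23 K"
proof -
  have "on23 K = on23 K ** on12 (matrix_inv R) ** on23 (matrix_inv R ** K)"
    using K212 by (simp add: K2_R1_R2_inv on23_mult matrix_mul_assoc)
  then have "on23 K = mat (inverse \<mu>) ** (on23 K ** on12 (matrix_inv R) ** on23 K)"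
    by (simp add: matrix_inv_R_K on23_mult mult_mat_mult)
  then show ?thesis using mat_mult_eq_iff by metis
qed

end

section \<open>\<open>K\<close> has rank one\<close>

lemma sum_swap_pairs:
  fixes f :: "'a::finite \<Rightarrow> 'b::finite \<Rightarrow> 'c::finite \<Rightarrow> 'd::finite \<Rightarrow> 'e::comm_monoid_add"
  shows "(\<Sum>c\<in>UNIV. \<Sum>d\<in>UNIV. \<Sum>a\<in>UNIV. \<Sum>b\<in>UNIV. f a b c d)
    = (\<Sum>a\<in>UNIV. \<Sum>b\<in>UNIV. \<Sum>c\<in>UNIV. \<Sum>d\<in>UNIV. f a b c d)"
proof -
  have "(\<Sum>p\<in>UNIV. \<Sum>r\<in>UNIV. f (fst r) (snd r) (fst p) (snd p))
    = (\<Sum>r\<in>UNIV. \<Sum>p\<in>UNIV. f (fst r) (snd r) (fst p) (snd p))"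
    by (rule sum.swap)
  then show ?thesis by (simp add: sum_UNIV_prod)
qed

lemma sum_delta_pair:
  fixes f :: "'a::finite \<Rightarrow> 'b::finite \<Rightarrow> 'c::semiring_1"
  shows "(\<Sum>a\<in>UNIV. \<Sum>b\<in>UNIV. f a b * (if a = a' \<and> b = b' then 1 else 0)) = f a' b'"
proof -
  have "(\<Sum>b\<in>UNIV. f a b * (if a = a' \<and> b = b' then 1 else 0)) = (if a = a' then f a b' else 0)" for a
    by (cases "a = a'") (simp_all add: mult_if_zero)
  then show ?thesis by simp
qed

text \<open>Contracting an array \<open>Q\<close> with the first-factor indices of \<open>X\<close>
  is a linear map that \<open>\<Psi>\<close> inverts. Inverting the scalar result \<nu> times the
  identity leaves \<nu> times a partial trace of \<open>\<Psi>\<close>.\<close>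

lemma skew_inverse_contract1:
  assumes "is_skew_inverse X \<Psi>"
    and Q: "\<And>c c'. (\<Sum>t\<in>UNIV. \<Sum>t'\<in>UNIV. Q t t' * X $ (t, c) $ (t', c')) = (if c = c' then \<nu> else 0)"
  shows "Q f e = \<nu> * tr1of2 \<Psi> $ e $ f"
proof -
  have "\<nu> * tr1of2 \<Psi> $ e $ f = (\<Sum>c\<in>UNIV. \<Sum>c'\<in>UNIV. (if c = c' then \<nu> else 0) * \<Psi> $ (c', e) $ (c, f))"
    by (simp add: sum_distrib_left mult_if_zero)
  also have "\<dots> = (\<Sum>c\<in>UNIV. \<Sum>c'\<in>UNIV. \<Sum>t\<in>UNIV. \<Sum>t'\<in>UNIV.
      Q t t' * (X $ (t, c) $ (t', c') * \<Psi> $ (c', e) $ (c, f)))"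
    by (simp add: sum_distrib_right mult.assoc flip: Q)
  also have "\<dots> = (\<Sum>t\<in>UNIV. \<Sum>t'\<in>UNIV. Q t t' *
      (\<Sum>c\<in>UNIV. \<Sum>c'\<in>UNIV. X $ (t, c) $ (t', c') * \<Psi> $ (c', e) $ (c, f)))"
    by (rule trans[OF sum_swap_pairs]) (simp add: sum_distrib_left)
  also have "\<dots> = (\<Sum>t\<in>UNIV. \<Sum>t'\<in>UNIV. Q t t' * (if t = f \<and> t' = e then 1 else 0))"
    unfolding skew_inverse_nth(1)[OF assms(1)] by (simp add: eq_commute[of e])
  also have "\<dots> = Q f e" by (rule sum_delta_pair)
  finally show ?thesis by simp
qed

lemma skew_inverse_contract2:
  assumes "is_skew_inverse X \<Psi>"
    and Q: "\<And>a a'. (\<Sum>s\<in>UNIV. \<Sum>s'\<in>UNIV. Q s s' * X $ (a, s) $ (a', s')) = (if a = a' then \<nu> else 0)"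
  shows "Q f e = \<nu> * tr2of2 \<Psi> $ e $ f"
proof -
  have "\<nu> * tr2of2 \<Psi> $ e $ f = (\<Sum>a'\<in>UNIV. \<Sum>a\<in>UNIV. (if a = a' then \<nu> else 0) * \<Psi> $ (e, a') $ (f, a))"
    by (simp add: sum_distrib_left mult_if_zero)
  also have "\<dots> = (\<Sum>a'\<in>UNIV. \<Sum>a\<in>UNIV. \<Sum>s\<in>UNIV. \<Sum>s'\<in>UNIV.
      Q s s' * (\<Psi> $ (e, a') $ (f, a) * X $ (a, s) $ (a', s')))"
    by (simp add: sum_distrib_left mult_ac flip: Q)
  also have "\<dots> = (\<Sum>s\<in>UNIV. \<Sum>s'\<in>UNIV. Q s s' *
      (\<Sum>a'\<in>UNIV. \<Sum>a\<in>UNIV. \<Psi> $ (e, a') $ (f, a) * X $ (a, s) $ (a', s')))"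
    by (rule trans[OF sum_swap_pairs]) (simp add: sum_distrib_left)
  also have "\<dots> = (\<Sum>s\<in>UNIV. \<Sum>s'\<in>UNIV. Q s s' * (if s = f \<and> s' = e then 1 else 0))"
    unfolding skew_inverse_nth(2)[OF assms(1)] by (simp add: eq_commute[of e] conj_commute)
  also have "\<dots> = Q f e" by (rule sum_delta_pair)
  finally show ?thesis by simp
qed

lemma is_skew_inverse_skew_inverse:
  "strict_skew_invertible R \<Longrightarrow> is_skew_inverse R (skew_inverse R)"
  unfolding strict_skew_invertible_def skew_invertible_def skew_inverse_def by (metis someI_ex)

context BMW
begin

text \<open>The sandwich identity \<open>K1_R2_K1\<close>, read entrywise, says that the two copies
  of \<open>K\<close> joined along \<open>s\<close> contract with \<open>R\<close> to a scalar
  matrix; the skew inverse then recovers this array.\<close>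

lemma K_contract1:
  assumes "strict_skew_invertible R"
  shows "(\<Sum>s\<in>UNIV. K $ x $ (s, f) * K $ (s, e) $ y) = inverse \<mu> * K $ x $ y * C_op R $ e $ f"
  unfolding C_op_def
proof (rule skew_inverse_contract1[OF is_skew_inverse_skew_inverse[OF assms]])
  fix c c'
  obtain a b a' b' where xy: "x = (a, b)" "y = (a', b')" by (metis surj_pair)
  have "(\<Sum>t\<in>UNIV. \<Sum>t'\<in>UNIV. (\<Sum>s\<in>UNIV. K $ x $ (s, t) * K $ (s, t') $ y) * R $ (t, c) $ (t', c'))
      = (on12 K ** on23 R ** on12 K) $ (a, b, c) $ (a', b', c')"
    unfolding on12_on23_on12_nth xy by (simp add: sum_distrib_left sum_distrib_right mult_ac)
  also have "\<dots> = (if c = c' then inverse \<mu> * K $ x $ y else 0)"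
    unfolding K1_R2_K1 by (simp add: xy)
  finally show "(\<Sum>t\<in>UNIV. \<Sum>t'\<in>UNIV. (\<Sum>s\<in>UNIV. K $ x $ (s, t) * K $ (s, t') $ y) * R $ (t, c) $ (t', c'))
      = (if c = c' then inverse \<mu> * K $ x $ y else 0)" .
qed

lemma K_contract2:
  assumes "strict_skew_invertible R"
  shows "(\<Sum>t\<in>UNIV. K $ x $ (f, t) * K $ (e, t) $ y) = inverse \<mu> * K $ x $ y * D_op R $ e $ f"
  unfolding D_op_def
proof (rule skew_inverse_contract2[OF is_skew_inverse_skew_inverse[OF assms]])
  fix c c'
  obtain a b a' b' where xy: "x = (a, b)" "y = (a', b')" by (metis surj_pair)
  have "(\<Sum>s\<in>UNIV. \<Sum>s'\<in>UNIV. (\<Sum>t\<in>UNIV. K $ x $ (s, t) * K $ (s', t) $ y) * R $ (c, s) $ (c', s'))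
      = (on23 K ** on12 R ** on23 K) $ (c, a, b) $ (c', a', b')"
    unfolding on23_on12_on23_nth xy by (simp add: sum_distrib_left sum_distrib_right mult_ac)
  also have "\<dots> = (if c = c' then inverse \<mu> * K $ x $ y else 0)"
    unfolding K2_R1_K2 by (simp add: xy)
  finally show "(\<Sum>s\<in>UNIV. \<Sum>s'\<in>UNIV. (\<Sum>t\<in>UNIV. K $ x $ (s, t) * K $ (s', t) $ y) * R $ (c, s) $ (c', s'))
      = (if c = c' then inverse \<mu> * K $ x $ y else 0)" .
qed

lemma K_rank_one:
  assumes "strict_skew_invertible R"
  obtains U V :: "complex ^ 'n ^ 'n"
  where "invertible U" "invertible V" "\<And>a b c d. K $ (a, b) $ (c, d) = U $ a $ b * V $ c $ d"
proof -
  obtain x0 y0 where k0: "K $ x0 $ y0 \<noteq> 0"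
    using K_nonzero by (metis vec_eq_iff zero_index)
  define k where "k = K $ x0 $ y0"
  \<comment> \<open>Row \<open>x0\<close> and column \<open>y\<close> of \<open>K\<close>, reshaped
    into square matrices; the row passes through a nonzero entry.\<close>
  define V where "V = (\<chi> s t. K $ x0 $ (s, t))"
  define U where "U y = (\<chi> s t. K $ (s, t) $ y)" for y
  have k: "k \<noteq> 0" using k0 by (simp add: k_def)
  \<comment> \<open>The last conjunct says that all columns are proportional to column
    \<open>y0\<close>, which is rank one. In either case \<open>V\<close> (or its transpose) times
    \<open>U y\<close> (or its transpose) is \<open>K $ x0 $ y\<close> times a fixed invertible
    matrix; cancelling the \<open>V\<close> factor gives the proportionality.\<close>
  have "(invertible V \<and> invertible (U y0)) \<and> (\<forall>y. mat k ** U y = mat (K $ x0 $ y) ** U y0)"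
    using assms[unfolded strict_skew_invertible_def, THEN conjunct2]
  proof
    assume C: "invertible (C_op R)"
    have 1: "transpose V ** U y = mat (inverse \<mu> * K $ x0 $ y) ** transpose (C_op R)" for y
      using K_contract1[OF assms, of x0 _ _ y] unfolding vec_eq_iff
      by (subst matrix_mult_nth) (simp add: V_def U_def transpose_def)
    have "invertible (transpose V ** U y0)"
      unfolding 1 using mu k C by (intro invertible_scale invertible_transpose) (auto simp: k_def)
    then have inv: "invertible (transpose V)" "invertible (U y0)"
      by (auto dest: invertible_factor)
    moreover have "mat k ** U y = mat (K $ x0 $ y) ** U y0" for y
    proof (rule matrix_mult_left_cancel[OF inv(1)])
      show "transpose V ** (mat k ** U y) = transpose V ** (mat (K $ x0 $ y) ** U y0)"
        unfolding mult_mat_mult unfolding 1 matrix_mul_assoc mat_mult_mat by (simp add: k_def mult_ac)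
    qed
    ultimately show ?thesis using invertible_transpose[OF inv(1)] by simp
  next
    assume D: "invertible (D_op R)"
    have 1: "V ** transpose (U y) = mat (inverse \<mu> * K $ x0 $ y) ** transpose (D_op R)" for y
      using K_contract2[OF assms, of x0 _ _ y] unfolding vec_eq_iff
      by (subst matrix_mult_nth) (simp add: V_def U_def transpose_def)
    have "invertible (V ** transpose (U y0))"
      unfolding 1 using mu k D by (intro invertible_scale invertible_transpose) (auto simp: k_def)
    then have inv: "invertible V" "invertible (transpose (U y0))"
      by (auto dest: invertible_factor)
    moreover have "mat k ** U y = mat (K $ x0 $ y) ** U y0" for y
    proof -
      have "V ** (mat k ** transpose (U y)) = V ** (mat (K $ x0 $ y) ** transpose (U y0))"
        unfolding mult_mat_mult unfolding 1 matrix_mul_assoc mat_mult_mat by (simp add: k_def mult_ac)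
      then have "mat k ** transpose (U y) = mat (K $ x0 $ y) ** transpose (U y0)"
        by (rule matrix_mult_left_cancel[OF inv(1)])
      then show ?thesis
        by (simp add: vec_eq_iff transpose_def)
    qed
    ultimately show ?thesis using invertible_transpose[OF inv(2)] by simp
  qed
  then have inv: "invertible V" "invertible (U y0)"
    and U: "\<And>y. mat k ** U y = mat (K $ x0 $ y) ** U y0"
    by auto
  show thesis
  proof
    show "invertible (mat (inverse k) ** U y0)"
      using inv k by (intro invertible_scale) auto
    show "invertible V" by fact
    show "K $ (a, b) $ (c, d) = (mat (inverse k) ** U y0) $ a $ b * V $ c $ d" for a b c d
    proof -
      have "(mat k ** U (c, d)) $ a $ b = (mat (K $ x0 $ (c, d)) ** U y0) $ a $ b"
        by (simp only: U)
      then show ?thesis using k by (simp add: U_def V_def field_simps)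
    qed
  qed
qed

end

section \<open>\<open>D_R\<close> and R-traces in terms of the rank-one factors\<close>

locale BMW_rank_one = BMW R q \<mu>
  for R :: "(complex, 'n::finite) op2" and q \<mu> :: complex +
  fixes U V :: "complex ^ 'n ^ 'n"
  assumes strict: "strict_skew_invertible R"
    and inv_V: "invertible V"
    and K_nth: "K $ (a, b) $ (c, d) = U $ a $ b * V $ c $ d"
begin

lemma U_V_nonzero: obtains a b c d where "U $ a $ b \<noteq> 0" "V $ c $ d \<noteq> 0"
proof -
  obtain a b c d where "K $ (a, b) $ (c, d) \<noteq> 0"
    using K_nonzero by (auto simp: vec_eq_iff)
  then show thesis using that by (auto simp: K_nth)
qed

lemma U_Vt_nth: "(U ** transpose V) $ a $ b = (\<Sum>t\<in>UNIV. U $ a $ t * V $ b $ t)"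
  by (simp add: matrix_mult_nth transpose_def)

text \<open>Inserting the factorization of \<open>K\<close> into \<open>K_contract2\<close> and
  dividing by a nonzero entry of \<open>K\<close> isolates \<open>D_op R\<close>.\<close>

lemma D_op_eq: "D_op R = mat \<mu> ** (U ** transpose V)"
proof -
  obtain a b c d where nz: "U $ a $ b \<noteq> 0" "V $ c $ d \<noteq> 0"
    by (rule U_V_nonzero)
  have "D_op R $ e $ f = \<mu> * (U ** transpose V) $ e $ f" for e f
  proof -
    have "(\<Sum>t\<in>UNIV. K $ (a, b) $ (f, t) * K $ (e, t) $ (c, d)) =
        U $ a $ b * V $ c $ d * (U ** transpose V) $ e $ f"
      by (simp add: K_nth U_Vt_nth sum_distrib_left mult_ac)
    moreover have "(\<Sum>t\<in>UNIV. K $ (a, b) $ (f, t) * K $ (e, t) $ (c, d)) =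
        inverse \<mu> * (U $ a $ b * V $ c $ d) * D_op R $ e $ f"
      using K_contract2[OF strict, of "(a, b)" f e "(c, d)"] by (simp only: K_nth)
    ultimately show ?thesis using nz mu by (simp add: field_simps)
  qed
  then show ?thesis by (simp add: vec_eq_iff)
qed

text \<open>Sandwiching between copies of \<open>K\<close> is the partial trace weighted by \<open>U V\<^sup>T = \<mu>\<^sup>-\<^sup>1 D\<^sub>R\<close>.\<close>

lemma sandwich:
  assumes "on23 K ** on12 B ** on23 K = mat c ** on23 K"
  shows "(\<Sum>s\<in>UNIV. \<Sum>s'\<in>UNIV. B $ (a, s) $ (a', s') * (U ** transpose V) $ s' $ s) =
    (if a = a' then c else 0)"
proof -
  obtain b d b' d' where nz: "U $ b $ d \<noteq> 0" "V $ b' $ d' \<noteq> 0"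
    by (rule U_V_nonzero)
  have "U $ b $ d * V $ b' $ d' *
      (\<Sum>s\<in>UNIV. \<Sum>s'\<in>UNIV. B $ (a, s) $ (a', s') * (U ** transpose V) $ s' $ s) =
      (on23 K ** on12 B ** on23 K) $ (a, b, d) $ (a', b', d')"
    unfolding on23_on12_on23_nth by (simp add: K_nth U_Vt_nth sum_distrib_left mult_ac)
  also have "\<dots> = U $ b $ d * V $ b' $ d' * (if a = a' then c else 0)"
    unfolding assms by (simp add: K_nth)
  finally show ?thesis using nz by simp
qed

text \<open>This is \<open>K2 K1 K2 = K2\<close>, that is, \<open>sandwich\<close> for
  \<open>B = K\<close>: the sum there becomes \<open>U (U V^T)^T V^T\<close>.\<close>

lemma U_V_Ut_Vt: "U ** V ** transpose U ** transpose V = mat 1"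
proof -
  have "(U ** V ** transpose U ** transpose V) $ a $ a' = mat 1 $ a $ a'" for a a'
  proof -
    define D where "D = U ** transpose V"
    have "U ** V ** transpose U ** transpose V = U ** (transpose D ** transpose V)"
      by (simp add: D_def matrix_transpose_mul matrix_mul_assoc)
    then have "(U ** V ** transpose U ** transpose V) $ a $ a' =
      (\<Sum>s\<in>UNIV. \<Sum>s'\<in>UNIV. K $ (a, s) $ (a', s') * D $ s' $ s)"
      by (simp add: matrix_mult_nth transpose_def K_nth sum_distrib_left mult_ac)
    also have "\<dots> = mat 1 $ a $ a'"
      using sandwich[of K 1] K212 by (simp add: mat_nth D_def)
    finally show ?thesis .
  qed
  then show ?thesis by (simp add: vec_eq_iff)
qed

text \<open>The weighted trace over the second factor sends \<open>R\<close>, its inverse,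
  \<open>K\<close> and \<open>1\<close> to \<open>1/\<mu>\<close>, \<mu>, \<open>1\<close> and the
  trace sought. The skein relation gives \<open>1/\<mu> - \<mu> = h (trace - 1)\<close>, whose
  solution is \<open>eta\<close>.\<close>

lemma trace_U_Vt: "trace (U ** transpose V) = eta q \<mu>"
proof -
  let ?D = "U ** transpose V"
  fix a :: 'n
  have R: "(\<Sum>s\<in>UNIV. \<Sum>s'\<in>UNIV. R $ (a, s) $ (a, s') * ?D $ s' $ s) = inverse \<mu>"
    using sandwich[OF K2_R1_K2, of a a] by simp
  have R': "(\<Sum>s\<in>UNIV. \<Sum>s'\<in>UNIV. matrix_inv R $ (a, s) $ (a, s') * ?D $ s' $ s) = \<mu>"
    using sandwich[OF K2_inv_R1_K2, of a a] by simp
  have K: "(\<Sum>s\<in>UNIV. \<Sum>s'\<in>UNIV. K $ (a, s) $ (a, s') * ?D $ s' $ s) = 1"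
    using sandwich[of K 1 a a] K212 by simp
  have I: "(\<Sum>s\<in>UNIV. \<Sum>s'\<in>UNIV. mat 1 $ (a, s) $ (a, s') * ?D $ s' $ s) = trace ?D"
    by (simp add: mat_nth trace_def mult_if_zero)
  have "R $ x $ y - matrix_inv R $ x $ y = h * (mat 1 $ x $ y - K $ x $ y)" for x y
    using R_minus_inv by (metis mat_mult_nth vector_minus_component)
  then have "(\<Sum>s\<in>UNIV. \<Sum>s'\<in>UNIV. (R $ (a, s) $ (a, s') - matrix_inv R $ (a, s) $ (a, s')) * ?D $ s' $ s)
      = (\<Sum>s\<in>UNIV. \<Sum>s'\<in>UNIV. h * (mat 1 $ (a, s) $ (a, s') - K $ (a, s) $ (a, s')) * ?D $ s' $ s)"
    by simp
  then have "inverse \<mu> - \<mu> = h * (trace ?D - 1)"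
    unfolding left_diff_distrib right_diff_distrib sum_subtractf R R'
    by (simp add: mult.assoc I K flip: sum_distrib_left)
  then have "h * \<mu> * trace ?D = 1 - \<mu> * \<mu> + h * \<mu>"
    using mu by (simp add: field_simps)
  moreover have "h * \<mu> * eta q \<mu> = 1 - \<mu> * \<mu> + h * \<mu>"
    using h_nonzero mu q_nonzero unfolding eta_def h_def[symmetric]
    by (simp add: h_def field_simps)
  ultimately show ?thesis using h_nonzero mu by (metis mult_eq_0_iff mult_left_cancel)
qed

lemma tr_D_K: "tr2of2 (on2 (D_op R) ** K) = mat \<mu>"
proof -
  have "tr2of2 (on2 (D_op R) ** K) $ a $ a' = mat \<mu> $ a $ a'" for a a'
  proof -
    have "tr2of2 (on2 (D_op R) ** K) $ a $ a' =
        (\<Sum>b\<in>UNIV. \<Sum>b'\<in>UNIV. D_op R $ b $ b' * (U $ a $ b' * V $ a' $ b))"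
      by (simp add: matrix_mult_nth sum_UNIV_prod mult_if_zero sum_if_zero K_nth cong: if_cong)
    also have "\<dots> = (U ** transpose (D_op R) ** transpose V) $ a $ a'"
      by (simp add: matrix_mult_nth transpose_def sum_distrib_left sum_distrib_right mult_ac)
    also have "U ** transpose (D_op R) ** transpose V = mat \<mu>"
      using U_V_Ut_Vt by (simp add: D_op_eq matrix_transpose_mul mult_mat_mult
          mat_mult_commute[of "_ ** _"] flip: matrix_mul_assoc)
    finally show ?thesis .
  qed
  then show ?thesis by (simp add: vec_eq_iff)
qed

text \<open>Tracing the second factor first leaves \<mu> times the trace of \<open>D_op R\<close>.
  The factor \<open>eta\<close> is the one that the normalization of the 2-contraction
  removes.\<close>

lemma trace_DD_K: "trace (on1 (D_op R) ** on2 (D_op R) ** K) = \<mu> * \<mu> * eta q \<mu>"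
proof -
  have *: "trace (on1 A ** Y) = trace (A ** tr2of2 Y)" for A :: "complex ^ 'n ^ 'n" and Y
  proof -
    have "trace (on1 A ** Y) = (\<Sum>a\<in>UNIV. \<Sum>b\<in>UNIV. \<Sum>a'\<in>UNIV. A $ a $ a' * Y $ (a', b) $ (a, b))"
      by (simp add: trace_def matrix_mult_nth sum_UNIV_prod mult_if_zero cong: if_cong)
    also have "\<dots> = (\<Sum>a\<in>UNIV. \<Sum>a'\<in>UNIV. \<Sum>b\<in>UNIV. A $ a $ a' * Y $ (a', b) $ (a, b))"
      by (rule sum.cong[OF refl sum.swap])
    finally show ?thesis by (simp add: trace_def matrix_mult_nth sum_distrib_left)
  qed
  have "trace (on1 (D_op R) ** on2 (D_op R) ** K) = trace (D_op R ** mat \<mu>)"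
    using *[of "D_op R" "on2 (D_op R) ** K"] by (simp add: tr_D_K matrix_mul_assoc)
  also have "\<dots> = \<mu> * \<mu> * trace (U ** transpose V)"
    by (simp add: trace_def D_op_eq sum_distrib_left mult_ac)
  finally show ?thesis by (simp add: trace_U_Vt)
qed

end

section \<open>The bilinear form \<open>v F\<close>\<close>

context BMW_rank_one
begin

definition W :: "(complex, 'n) op2 \<Rightarrow> complex ^ 'n ^ 'n" where
  "W F = (\<chi> e f. \<Sum>a\<in>UNIV. \<Sum>b\<in>UNIV. V $ a $ b * F $ (a, b) $ (e, f))"

lemma K_F_nth: "(K ** F) $ (a, b) $ (e, f) = U $ a $ b * W F $ e $ f"
  by (simp add: matrix_mult_nth sum_UNIV_prod K_nth W_def sum_distrib_left mult_ac)

text \<open>In index-free form the hypothesis below says that \<open>x\<close> lies in the left kernel \<open>L\<close> of \<open>W\<close>, and the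
  conclusion that \<open>F (L \<otimes> \<complex>\<^sup>n) \<subseteq> \<complex>\<^sup>n \<otimes> L\<close>.  The reason is
  \<open>(KF)\<^sub>2 F\<^sub>1 = F\<^sub>1 F\<^sub>2 (KF)\<^sub>1 F\<^sub>2\<^sup>-\<^sup>1\<close>, whose right-hand side annihilates \<open>L\<close> in the first factor.\<close>

lemma F_left_kernel:
  assumes F: "is_R_matrix F" and RF: "compatible_pair R F"
    and x: "\<And>f. (\<Sum>e\<in>UNIV. x e * W F $ e $ f) = 0"
  shows "(\<Sum>m\<in>UNIV. (\<Sum>e\<in>UNIV. F $ (a, m) $ (e, f) * x e) * W F $ m $ c) = 0"
proof -
  obtain b d where nz: "U $ b $ d \<noteq> 0" using U_V_nonzero by metis
  let ?Z = "on12 F ** on23 F" and ?F' = "on23 (matrix_inv F)"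
  have F_inv: "on23 F ** ?F' = mat 1"
    using F matrix_inv_mult(1)[of F] by (simp add: is_R_matrix_def flip: on23_mult)
  have Z: "?Z ** on12 K = on23 K ** ?Z"
    using RF by (intro intertwine_K) (simp add: compatible_pair_def matrix_mul_assoc)
  have braid_F: "on12 F ** on23 F ** on12 F = on23 F ** on12 F ** on23 F"
    using F by (simp add: is_R_matrix_def)
  \<comment> \<open>Inserting \<open>F2\<close> and its inverse on the right makes the braid
    relation for \<open>F\<close> applicable; then \<open>F1 F2\<close> carries \<open>K2\<close> to
    \<open>K1\<close>.\<close>
  have "on23 (K ** F) ** on12 F = on23 K ** (on23 F ** on12 F ** on23 F) ** ?F'"
    using F_inv by (simp add: on23_mult flip: matrix_mul_assoc)
  also have "\<dots> = (on23 K ** ?Z) ** on12 F ** ?F'"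
    by (simp add: matrix_mul_assoc flip: braid_F)
  also have "\<dots> = ?Z ** (on12 (K ** F) ** ?F')"
    unfolding Z[symmetric] by (simp add: on12_mult flip: matrix_mul_assoc)
  finally have eq: "on23 (K ** F) ** on12 F = ?Z ** (on12 (K ** F) ** ?F')" .
  have "(on12 (K ** F) ** ?F') $ (i, j, k) $ (e, f, c) =
      (\<Sum>m\<in>UNIV. U $ i $ j * W F $ e $ m * matrix_inv F $ (m, k) $ (f, c))" for i j k e
    by (simp add: matrix_mult_nth sum_UNIV_prod mult_if_zero sum_if_zero flip: K_F_nth cong: if_cong)
  then have "(\<Sum>e\<in>UNIV. x e * (on12 (K ** F) ** ?F') $ (i, j, k) $ (e, f, c)) =
      (\<Sum>e\<in>UNIV. \<Sum>m\<in>UNIV. U $ i $ j * matrix_inv F $ (m, k) $ (f, c) * (x e * W F $ e $ m))" for i j k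
    by (simp add: sum_distrib_left mult_ac)
  also have "\<dots> i j k = (\<Sum>m\<in>UNIV. U $ i $ j * matrix_inv F $ (m, k) $ (f, c) * (\<Sum>e\<in>UNIV. x e * W F $ e $ m))" for i j k
    by (subst sum.swap) (simp add: sum_distrib_left)
  finally have 0: "(\<Sum>e\<in>UNIV. x e * (on12 (K ** F) ** ?F') $ (i, j, k) $ (e, f, c)) = 0" for i j k
    by (simp add: x)
  have "U $ b $ d * (\<Sum>m\<in>UNIV. (\<Sum>e\<in>UNIV. F $ (a, m) $ (e, f) * x e) * W F $ m $ c) =
      (\<Sum>m\<in>UNIV. \<Sum>e\<in>UNIV. x e * (U $ b $ d * W F $ m $ c * F $ (a, m) $ (e, f)))"
    by (simp add: sum_distrib_left sum_distrib_right mult_ac)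
  also have "\<dots> = (\<Sum>e\<in>UNIV. x e * (\<Sum>m\<in>UNIV. U $ b $ d * W F $ m $ c * F $ (a, m) $ (e, f)))"
    by (subst sum.swap) (simp add: sum_distrib_left)
  also have "\<dots> = (\<Sum>e\<in>UNIV. x e * (on23 (K ** F) ** on12 F) $ (a, b, d) $ (e, f, c))"
    by (simp add: matrix_mult_nth[of "on23 _"] sum_UNIV_prod mult_if_zero sum_if_zero K_F_nth cong: if_cong)
  also have "\<dots> = (\<Sum>e\<in>UNIV. \<Sum>p\<in>UNIV. ?Z $ (a, b, d) $ p * (x e * (on12 (K ** F) ** ?F') $ p $ (e, f, c)))"
    unfolding eq by (simp add: matrix_mult_nth[of ?Z] sum_distrib_left mult_ac)
  also have "\<dots> = (\<Sum>p\<in>UNIV. ?Z $ (a, b, d) $ p * (\<Sum>e\<in>UNIV. x e * (on12 (K ** F) ** ?F') $ p $ (e, f, c)))"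
    by (subst sum.swap) (simp add: sum_distrib_left)
  also have "\<dots> = 0"
    by (intro sum.neutral ballI) (simp add: 0 split_paired_all)
  finally show ?thesis using nz by simp
qed

text \<open>By dimension \<open>F (L \<otimes> \<complex>\<^sup>n) = \<complex>\<^sup>n \<otimes> L\<close>, so \<open>v\<close> vanishes on \<open>\<complex>\<^sup>n \<otimes> L\<close> because \<open>v F\<close> vanishes on
  \<open>L \<otimes> \<complex>\<^sup>n\<close>; as \<open>v\<close> is nondegenerate, \<open>L = 0\<close>.  Below, \<open>S\<close> is \<open>L \<otimes> \<complex>\<^sup>n\<close> and \<open>\<Phi>\<close> is \<open>F\<close> followed by the
  flip.\<close>

lemma invertible_W:
  assumes F: "is_R_matrix F" and RF: "compatible_pair R F"
  shows "invertible (W F)"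
proof -
  define S :: "(complex ^ 'n ^ 'n) set"
    where "S = {T. \<forall>c f. (\<Sum>e\<in>UNIV. T $ e $ f * W F $ e $ c) = 0}"
  define \<Phi> :: "complex ^ 'n ^ 'n \<Rightarrow> complex ^ 'n ^ 'n"
    where "\<Phi> T = (\<chi> m a. \<Sum>e\<in>UNIV. \<Sum>f\<in>UNIV. F $ (a, m) $ (e, f) * T $ e $ f)" for T
  \<comment> \<open>Subspaces, linearity and dimensions are taken over the reals here, which
    suffices for the dimension count.\<close>
  have S: "subspace S"
    unfolding S_def subspace_def
    by (auto simp: distrib_right sum.distrib scaleR_sum_right[symmetric])
  have "linear \<Phi>"
    by (rule linearI) (simp_all add: \<Phi>_def vec_eq_iff distrib_left sum.distrib scaleR_sum_right)
  have "inj \<Phi>"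
    unfolding linear_injective_0[OF \<open>linear \<Phi>\<close>]
  proof (intro allI impI)
    fix T assume "\<Phi> T = 0"
    let ?t = "vec_lambda (\<lambda>(e, f). T $ e $ f)"
    have "(F *v ?t) $ (a, m) = \<Phi> T $ m $ a" for a m
      by (simp add: matrix_vector_mult_def \<Phi>_def sum_UNIV_prod)
    then have "F *v ?t = 0"
      using \<open>\<Phi> T = 0\<close> by (simp add: vec_eq_iff split_paired_all)
    then have "matrix_inv F ** F *v ?t = 0"
      by (simp flip: matrix_vector_mul_assoc)
    then have "?t = 0"
      using F by (simp add: matrix_inv_mult is_R_matrix_def)
    then have "?t $ (e, f) = 0" for e f by simp
    then show "T = 0" by (simp add: vec_eq_iff)
  qed
  have "\<Phi> T \<in> S" if "T \<in> S" for T
  proof -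
    have "(\<Sum>m\<in>UNIV. \<Phi> T $ m $ a * W F $ m $ c) = 0" for a c
    proof -
      have "(\<Sum>m\<in>UNIV. \<Phi> T $ m $ a * W F $ m $ c) =
          (\<Sum>m\<in>UNIV. \<Sum>f\<in>UNIV. (\<Sum>e\<in>UNIV. F $ (a, m) $ (e, f) * T $ e $ f) * W F $ m $ c)"
        unfolding \<Phi>_def by (simp add: sum_distrib_right) (rule sum.cong[OF refl sum.swap])
      also have "\<dots> = (\<Sum>f\<in>UNIV. \<Sum>m\<in>UNIV. (\<Sum>e\<in>UNIV. F $ (a, m) $ (e, f) * T $ e $ f) * W F $ m $ c)"
        by (rule sum.swap)
      also have "\<dots> = 0"
        
        by (rule sum.neutral) (use that in \<open>auto simp: S_def simp del: mult_eq_0_iff intro!: F_left_kernel[OF F RF]\<close>)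
      finally show ?thesis .
    qed
    then show ?thesis by (simp add: S_def)
  qed
  then have "\<Phi> ` S \<subseteq> S" by blast
  moreover have "dim (\<Phi> ` S) = dim S"
    by (rule dim_image_eq[OF \<open>linear \<Phi>\<close>]) (use \<open>inj \<Phi>\<close> in \<open>auto intro: inj_on_subset\<close>)
  ultimately have \<Phi>S: "\<Phi> ` S = S"
    using S \<open>linear \<Phi>\<close> by (intro subspace_dim_equal linear_subspace_image) auto
  have V0: "(\<Sum>a\<in>UNIV. \<Sum>b\<in>UNIV. V $ a $ b * T $ b $ a) = 0" if "T \<in> S" for T
  proof -
    have "T \<in> \<Phi> ` S" using that by (simp only: \<Phi>S)
    then obtain T' where T': "T = \<Phi> T'" "T' \<in> S" by (rule imageE)
    have "(\<Sum>a\<in>UNIV. \<Sum>b\<in>UNIV. V $ a $ b * T $ b $ a) =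
        (\<Sum>a\<in>UNIV. \<Sum>b\<in>UNIV. \<Sum>e\<in>UNIV. \<Sum>f\<in>UNIV. V $ a $ b * F $ (a, b) $ (e, f) * T' $ e $ f)"
      unfolding T' by (simp add: \<Phi>_def sum_distrib_left mult_ac)
    also have "\<dots> = (\<Sum>e\<in>UNIV. \<Sum>f\<in>UNIV. T' $ e $ f * W F $ e $ f)"
      by (rule trans[OF sum_swap_pairs]) (simp add: W_def sum_distrib_left mult_ac)
    also have "\<dots> = (\<Sum>f\<in>UNIV. \<Sum>e\<in>UNIV. T' $ e $ f * W F $ e $ f)"
      by (rule sum.swap)
    also have "\<dots> = 0" using T'(2) by (simp add: S_def)
    finally show ?thesis .
  qed
  have "x = 0" if "transpose (W F) *v x = 0" for x
  proof -
    \<comment> \<open>The test tensor \<open>x\<close> times the basis vector \<open>a\<close>: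
      \<open>V0\<close> applied to it is the vanishing of component \<open>a\<close> of
      \<open>V *v x\<close>.\<close>
    have "(\<chi> e f. if f = a then x $ e else 0) \<in> S" for a
      using that by (auto simp: S_def vec_eq_iff matrix_vector_mult_def transpose_def mult_if_zero
          sum_if_zero mult.commute[of "W F $ _ $ _"] cong: if_cong)
    from V0[OF this] have "(\<Sum>b\<in>UNIV. V $ a $ b * x $ b) = 0" for a
      by (simp add: mult_if_zero sum_if_zero)
    then have "V *v x = 0" by (simp add: vec_eq_iff matrix_vector_mult_def)
    then have "matrix_inv V ** V *v x = 0" by (simp flip: matrix_vector_mul_assoc)
    then show ?thesis using inv_V by (simp add: matrix_inv_mult)
  qed
  then have "invertible (transpose (W F))"
    unfolding invertible_left_inverse matrix_left_invertible_ker by blast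
  then show ?thesis using invertible_transpose by fastforce
qed

end

section \<open>Constants in the free algebra\<close>

lemma free_const_0 [simp]: "free_const 0 = 0"
  and free_const_1 [simp]: "free_const 1 = 1"
  and free_const_add: "free_const (c + d) = free_const c + free_const d"
  and free_const_diff: "free_const (c - d) = free_const c - free_const d"
  and free_const_mult: "free_const (c * d) = free_const c * free_const d"
  by (simp_all add: free_const_def single_add single_diff mult_single)

lemma free_const_sum: "free_const (sum f A) = (\<Sum>x\<in>A. free_const (f x))"
  by (induction A rule: infinite_finite_induct) (simp_all add: free_const_add)

text \<open>Constants sit at the empty word, which is neutral on both sides of concatenation, so
  they commute with each monomial; induction on the monomials does the rest.\<close>

lemma free_const_commute: "x * free_const c = free_const c * x"
proof (induction x rule: Poly_Mapping.update_induct)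
  case (update f a b)
  have "Poly_Mapping.update a b f = Poly_Mapping.single a b + f"
    using update(1) by (intro poly_mapping_eqI)
      (auto simp: lookup_update lookup_add lookup_single when_def in_keys_iff)
  then show ?case
    using update by (simp add: distrib_left distrib_right free_const_def mult_single mult.commute)
qed simp

lemma free_const_left_commute: "x * (free_const c * y) = free_const c * (x * y)"
  by (metis free_const_commute mult.assoc)

lemma free_const_mat_nth [simp]: "free_const_mat X $ i $ j = free_const (X $ i $ j)"
  by (simp add: free_const_mat_def)

lemma free_const_mat_mult: "free_const_mat (A ** B) = free_const_mat A ** free_const_mat B"
  and free_const_mat_add: "free_const_mat (A + B) = free_const_mat A + free_const_mat B"
  and free_const_mat_diff: "free_const_mat (A - B) = free_const_mat A - free_const_mat B"
  and free_const_mat_mat: "free_const_mat (mat c) = mat (free_const c)"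
  by (simp_all add: vec_eq_iff matrix_mult_nth free_const_sum free_const_mult free_const_add
      free_const_diff mat_nth)

section \<open>Congruence modulo a two-sided ideal\<close>

text \<open>Computing with congruences in the free algebra, rather than with cosets, keeps the
  type-class arithmetic and the matrix product \<open>**\<close> available. Only the final result is
  transported to the quotient.\<close>

locale two_sided_ideal =
  fixes I :: "'a::ring_1 set"
  assumes add: "x \<in> I \<Longrightarrow> y \<in> I \<Longrightarrow> x + y \<in> I"
    and mult_left: "x \<in> I \<Longrightarrow> a * x \<in> I"
    and mult_right: "x \<in> I \<Longrightarrow> x * a \<in> I"
    and zero: "0 \<in> I"
begin

definition eqv :: "'a \<Rightarrow> 'a \<Rightarrow> bool" (infix "\<doteq>" 50)
  where "x \<doteq> y \<longleftrightarrow> x - y \<in> I"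

definition mat_eqv :: "'a ^ 'm ^ 'k \<Rightarrow> 'a ^ 'm ^ 'k \<Rightarrow> bool" (infix "\<doteq>\<doteq>" 50)
  where "X \<doteq>\<doteq> Y \<longleftrightarrow> (\<forall>i j. X $ i $ j \<doteq> Y $ i $ j)"

lemma eqv_refl [simp]: "x \<doteq> x"
  by (simp add: eqv_def zero)

lemma eqv_sym: "x \<doteq> y \<Longrightarrow> y \<doteq> x"
  using mult_left[of "x - y" "- 1"] by (simp add: eqv_def)

lemma eqv_trans [trans]: "x \<doteq> y \<Longrightarrow> y \<doteq> z \<Longrightarrow> x \<doteq> z"
  using add[of "x - y" "y - z"] by (simp add: eqv_def)

lemma eqv_add: "x \<doteq> y \<Longrightarrow> x' \<doteq> y' \<Longrightarrow> x + x' \<doteq> y + y'"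
  using add[of "x - y" "x' - y'"] by (simp add: eqv_def algebra_simps)

lemma eqv_mult: "x \<doteq> y \<Longrightarrow> x' \<doteq> y' \<Longrightarrow> x * x' \<doteq> y * y'"
  using add[OF mult_right[of "x - y" x'] mult_left[of "x' - y'" y]]
  by (simp add: eqv_def algebra_simps)

lemma eqv_diff: "x \<doteq> y \<Longrightarrow> x' \<doteq> y' \<Longrightarrow> x - x' \<doteq> y - y'"
  using eqv_add[of x y "- 1 * x'" "- 1 * y'"] eqv_mult[of "- 1" "- 1" x' y'] by simp

lemma eqv_sum: "(\<And>i. i \<in> A \<Longrightarrow> f i \<doteq> g i) \<Longrightarrow> sum f A \<doteq> sum g A"
  by (induction A rule: infinite_finite_induct) (simp_all add: eqv_add)

lemma mat_eqv_nth: "X \<doteq>\<doteq> Y \<Longrightarrow> X $ i $ j \<doteq> Y $ i $ j"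
  by (simp add: mat_eqv_def)

lemma mat_eqv_refl [simp]: "X \<doteq>\<doteq> X"
  by (simp add: mat_eqv_def)

lemma mat_eqv_sym: "X \<doteq>\<doteq> Y \<Longrightarrow> Y \<doteq>\<doteq> X"
  by (simp add: mat_eqv_def eqv_sym)

lemma mat_eqv_trans [trans]: "X \<doteq>\<doteq> Y \<Longrightarrow> Y \<doteq>\<doteq> Z \<Longrightarrow> X \<doteq>\<doteq> Z"
  unfolding mat_eqv_def by (blast intro: eqv_trans)

lemma mat_eqv_add: "X \<doteq>\<doteq> Y \<Longrightarrow> X' \<doteq>\<doteq> Y' \<Longrightarrow> X + X' \<doteq>\<doteq> Y + Y'"
  and mat_eqv_diff: "X \<doteq>\<doteq> Y \<Longrightarrow> X' \<doteq>\<doteq> Y' \<Longrightarrow> X - X' \<doteq>\<doteq> Y - Y'"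
  by (simp_all add: mat_eqv_def eqv_add eqv_diff)

lemma mat_eqv_mult: "X \<doteq>\<doteq> Y \<Longrightarrow> X' \<doteq>\<doteq> Y' \<Longrightarrow> X ** X' \<doteq>\<doteq> Y ** Y'"
  by (simp add: mat_eqv_def matrix_mult_nth eqv_sum eqv_mult)

text \<open>The usual \<open>L = L (X N) = (L X) N = N\<close>, modulo the ideal. Over a
  noncommutative ring a left inverse has to be supplied separately.\<close>

lemma mat_eqv_left_right_inverse:
  assumes "L ** X \<doteq>\<doteq> mat 1" "X ** N \<doteq>\<doteq> mat 1"
  shows "N ** X \<doteq>\<doteq> mat 1"
proof -
  have "L ** (X ** N) \<doteq>\<doteq> L" "(L ** X) ** N \<doteq>\<doteq> N"
    using mat_eqv_mult[OF mat_eqv_refl[of L] assms(2)] mat_eqv_mult[OF assms(1) mat_eqv_refl[of N]]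
    by simp_all
  then have "N \<doteq>\<doteq> L"
    by (metis mat_eqv_sym mat_eqv_trans matrix_mul_assoc)
  from mat_eqv_mult[OF this mat_eqv_refl[of X]] assms(1) show ?thesis
    by (rule mat_eqv_trans)
qed

end

section \<open>Matrices over a presented algebra\<close>

lemma free_alg_ring_simps [simp]:
  "carrier free_alg_ring = UNIV" "x \<otimes>\<^bsub>free_alg_ring\<^esub> y = x * y" "\<one>\<^bsub>free_alg_ring\<^esub> = 1"
  "\<zero>\<^bsub>free_alg_ring\<^esub> = 0" "x \<oplus>\<^bsub>free_alg_ring\<^esub> y = x + y"
  by (simp_all add: free_alg_ring_def)

lemma ring_free_alg_ring: "ring free_alg_ring"
proof (rule ringI)
  show "abelian_group free_alg_ring"
    by (rule abelian_groupI) (auto simp: add.assoc add.commute intro: exI[of _ "- _"])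
  show "monoid free_alg_ring"
    by (rule monoidI) (auto simp: mult.assoc)
qed (auto simp: distrib_left distrib_right)

lemma ideal_Idl: "ideal (Idl\<^bsub>free_alg_ring\<^esub> S) free_alg_ring"
  by (rule ring.genideal_ideal[OF ring_free_alg_ring]) simp

lemma Idl_superset: "S \<subseteq> Idl\<^bsub>free_alg_ring\<^esub> S"
  by (rule ring.genideal_self[OF ring_free_alg_ring]) simp

lemma two_sided_ideal_Idl: "two_sided_ideal (Idl\<^bsub>free_alg_ring\<^esub> S)"
proof -
  interpret ideal "Idl\<^bsub>free_alg_ring\<^esub> S" free_alg_ring by (rule ideal_Idl)
  show ?thesis
    using additive_subgroup.a_closed[OF is_additive_subgroup] I_l_closed I_r_closed
      additive_subgroup.zero_closed[OF is_additive_subgroup]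
    by unfold_locales auto
qed

lemma presented_class_hom: "ring_hom_ring free_alg_ring (presented_alg S) (presented_class S)"
  using ideal.rcos_ring_hom_ring[OF ideal_Idl[of S]]
  by (simp add: presented_alg_def presented_class_def[abs_def])

lemma presented_class_eqI:
  assumes "x - y \<in> Idl\<^bsub>free_alg_ring\<^esub> S"
  shows "presented_class S x = presented_class S y"
proof -
  interpret ring_hom_ring free_alg_ring "presented_alg S" "presented_class S"
    by (rule presented_class_hom)
  have "presented_class S (x - y) = presented_class S 0"
    using ring.a_rcos_zero[OF ring_free_alg_ring ideal_Idl assms]
      ring.a_rcos_zero[OF ring_free_alg_ring ideal_Idl two_sided_ideal.zero[OF two_sided_ideal_Idl[of S]]]
    by (simp add: presented_class_def)
  then have "presented_class S (x - y) \<oplus>\<^bsub>presented_alg S\<^esub> presented_class S y =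
      presented_class S 0 \<oplus>\<^bsub>presented_alg S\<^esub> presented_class S y"
    by simp
  then show ?thesis
    using hom_add[of "x - y" y] hom_add[of 0 y] by simp
qed

lemma presented_class_carrier: "presented_class S x \<in> carrier (presented_alg S)"
  using ring_hom_ring.homh[OF presented_class_hom[of S]] by (auto simp: ring_hom_def)

lemma finsum_presented_class:
  "(\<Oplus>\<^bsub>presented_alg S\<^esub>k\<in>A. presented_class S (f k)) = presented_class S (sum f A)"
proof -
  interpret ring_hom_ring free_alg_ring "presented_alg S" "presented_class S"
    by (rule presented_class_hom)
  show ?thesis
  proof (induction A rule: infinite_finite_induct)
    case (insert x F)
    then show ?case
      using hom_add[of "f x" "sum f F"] by (simp add: presented_class_carrier)
  qed (use hom_zero in simp_all)
qed

lemma ring_mat_mult_presented: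
  "ring_mat_mult (presented_alg S) (presented_class_mat S X) (presented_class_mat S Y) =
    presented_class_mat S (X ** Y)"
proof -
  interpret ring_hom_ring free_alg_ring "presented_alg S" "presented_class S"
    by (rule presented_class_hom)
  have "presented_class S x \<otimes>\<^bsub>presented_alg S\<^esub> presented_class S y = presented_class S (x * y)" for x y
    using hom_mult[of x y] by simp
  then show ?thesis
    by (simp add: vec_eq_iff finsum_presented_class ring_mat_mult_def presented_class_mat_def matrix_mult_nth)
qed

lemma ring_mat_one_presented: "ring_mat_one (presented_alg S) = presented_class_mat S (mat 1)"
proof -
  interpret ring_hom_ring free_alg_ring "presented_alg S" "presented_class S"
    by (rule presented_class_hom)
  show ?thesis
    using hom_one hom_zero
    by (simp add: vec_eq_iff ring_mat_one_def presented_class_mat_def mat_nth)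
qed

lemma presented_class_mat_eqI:
  assumes "two_sided_ideal.mat_eqv (Idl\<^bsub>free_alg_ring\<^esub> S) X Y"
  shows "presented_class_mat S X = presented_class_mat S Y"
  using assms two_sided_ideal_Idl[of S]
  by (auto simp: presented_class_mat_def vec_eq_iff two_sided_ideal.mat_eqv_def
      two_sided_ideal.eqv_def intro!: presented_class_eqI)

section \<open>The inverse of the generating matrix\<close>

lemma on1_free_const_on2_commute:
  "on1 M ** free_const_mat (on2 D) = free_const_mat (on2 D) ** on1 M"
  by (auto simp: vec_eq_iff matrix_mult_nth sum_UNIV_prod mult_if_zero sum_if_zero if_distrib[of free_const]
      free_const_commute[of "M $ _ $ _"] cong: if_cong)

lemma tr2of2_on1_mult: "tr2of2 (on1 M ** Y) = M ** tr2of2 Y"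
proof -
  have "tr2of2 (on1 M ** Y) $ a $ a' = (\<Sum>b\<in>UNIV. \<Sum>c\<in>UNIV. M $ a $ c * Y $ (c, b) $ (a', b))" for a a'
    by (simp add: matrix_mult_nth sum_UNIV_prod mult_if_zero cong: if_cong)
  also have "\<dots> a a' = (\<Sum>c\<in>UNIV. \<Sum>b\<in>UNIV. M $ a $ c * Y $ (c, b) $ (a', b))" for a a'
    by (rule sum.swap)
  finally show ?thesis by (simp add: vec_eq_iff matrix_mult_nth sum_distrib_left)
qed

text \<open>\<open>g'\<close> plays the inverse of the 2-contraction. \<open>eta\<close> must be
  nonzero for the factor \<open>inverse (eta q \<mu>)\<close> in the 2-contraction to be a genuine
  normalization.\<close>

locale qma_ideal = BMW_rank_one R q \<mu> U V + two_sided_ideal I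
  for R :: "(complex, 'n::finite) op2" and q \<mu> :: complex and U V :: "complex ^ 'n ^ 'n"
    and I :: "'g free_alg set" +
  fixes F :: "(complex, 'n) op2" and M :: "('g free_alg, 'n) op1" and g' :: "'g free_alg"
  assumes F: "is_R_matrix F" and RF: "compatible_pair R F" and eta: "eta q \<mu> \<noteq> 0"
    and relators: "qma_relators R F M \<subseteq> I"
    and g'_left: "g' * two_contraction q \<mu> R F M - 1 \<in> I"
    and g'_right: "two_contraction q \<mu> R F M * g' - 1 \<in> I"
begin

definition "X = M_bar1 M ** M_bar2 F M"

lemma R_X: "free_const_mat R ** X \<doteq>\<doteq> X ** free_const_mat R"
  unfolding mat_eqv_def eqv_def
proof (intro allI)
  fix i j
  have "(free_const_mat R ** X - X ** free_const_mat R) $ i $ j \<in> qma_relators R F M"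
    unfolding qma_relators_def X_def matrix_mul_assoc by blast
  then show "(free_const_mat R ** X) $ i $ j - (X ** free_const_mat R) $ i $ j \<in> I"
    using relators by auto
qed

text \<open>\<open>K\<close> is a polynomial in \<open>R\<close> with central coefficients, so it
  commutes with \<open>X\<close> modulo \<open>I\<close> as \<open>R\<close> does.\<close>

lemma K_X: "free_const_mat K ** X \<doteq>\<doteq> X ** free_const_mat K"
proof -
  let ?R = "free_const_mat R :: ('g free_alg, 'n) op2"
  have comm: "Y ** mat (free_const c) = mat (free_const c) ** Y" for c and Y :: "('g free_alg, 'n) op2"
    by (simp add: vec_eq_iff free_const_commute)
  have comm': "Y ** (mat (free_const c) ** Z) = mat (free_const c) ** (Y ** Z)"
    for c and Y Z :: "('g free_alg, 'n) op2"
    by (simp add: matrix_mul_assoc comm)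
  have RRX: "?R ** (?R ** X) \<doteq>\<doteq> X ** (?R ** ?R)"
    using mat_eqv_trans[OF mat_eqv_mult[OF mat_eqv_refl[of ?R] R_X]]
      mat_eqv_mult[OF R_X mat_eqv_refl[of ?R]] by (simp add: matrix_mul_assoc)
  show ?thesis
    unfolding K_eq free_const_mat_add free_const_mat_diff free_const_mat_mult free_const_mat_mat
      matrix_distribs comm' comm[of X] matrix_mul_assoc[symmetric]
    by (intro mat_eqv_add mat_eqv_diff mat_eqv_mult mat_eqv_refl RRX R_X)
qed

lemma const_mult_eqv:
  assumes "\<And>y z. Y $ y $ z \<doteq> \<gamma> * free_const (B $ y $ z)"
  shows "(free_const_mat A ** Y) $ x $ z \<doteq> \<gamma> * free_const ((A ** B) $ x $ z)"
proof -
  have "(free_const_mat A ** Y) $ x $ z \<doteq> (\<Sum>y\<in>UNIV. free_const (A $ x $ y) * (\<gamma> * free_const (B $ y $ z)))"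
    unfolding matrix_mult_nth by (intro eqv_sum eqv_mult) (simp_all add: assms)
  also have "\<dots> = \<gamma> * free_const ((A ** B) $ x $ z)"
    by (simp add: matrix_mult_nth free_const_sum free_const_mult sum_distrib_left
        free_const_left_commute[of \<gamma>])
  finally show ?thesis .
qed

text \<open>Entrywise \<open>K X\<close> is \<open>u\<close> times \<open>v X\<close>, and
  \<open>X K\<close> is \<open>X u\<close> times \<open>v\<close>; their congruence makes
  \<open>v X\<close> a multiple of \<open>v\<close>. Both conclusions share one \<gamma>, so that
  the left-inverse argument can identify it through the 2-contraction.\<close>

lemma contraction_eigenvalue:
  obtains \<gamma> where
    "\<forall>e f. (\<Sum>a\<in>UNIV. \<Sum>b\<in>UNIV. free_const (V $ a $ b) * X $ (a, b) $ (e, f)) \<doteq> \<gamma> * free_const (V $ e $ f)"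
    "\<forall>x y. (X ** free_const_mat K) $ x $ y \<doteq> \<gamma> * free_const (K $ x $ y)"
proof -
  obtain a b c d where nz: "U $ a $ b \<noteq> 0" "V $ c $ d \<noteq> 0" by (rule U_V_nonzero)
  define vX where "vX e f = (\<Sum>a\<in>UNIV. \<Sum>b\<in>UNIV. free_const (V $ a $ b) * X $ (a, b) $ (e, f))" for e f
  define Xu where "Xu x = (\<Sum>a\<in>UNIV. \<Sum>b\<in>UNIV. X $ x $ (a, b) * free_const (U $ a $ b))" for x
  \<comment> \<open>Obtained by dividing the \<open>(a, b)\<close> row of the congruence by the
    nonzero scalar \<open>U $ a $ b\<close>.\<close>
  define \<gamma> where "\<gamma> = free_const (inverse (U $ a $ b)) * Xu (a, b)"
  have KX: "(free_const_mat K ** X) $ (a, b) $ (e, f) = free_const (U $ a $ b) * vX e f" for a b e f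
    by (simp add: matrix_mult_nth sum_UNIV_prod K_nth vX_def free_const_mult sum_distrib_left mult.assoc)
  have XK: "(X ** free_const_mat K) $ x $ (e, f) = Xu x * free_const (V $ e $ f)" for x e f
    by (simp add: matrix_mult_nth sum_UNIV_prod K_nth Xu_def free_const_mult sum_distrib_right mult.assoc)
  have "free_const (inverse (U $ a $ b)) * (free_const (U $ a $ b) * vX e f) \<doteq>
      free_const (inverse (U $ a $ b)) * (Xu (a, b) * free_const (V $ e $ f))" for e f
    using mat_eqv_nth[OF K_X, of "(a, b)" "(e, f)"] unfolding KX XK by (intro eqv_mult[OF eqv_refl])
  moreover have "free_const (inverse (U $ a $ b)) * free_const (U $ a $ b) = (1 :: 'g free_alg)"
    using nz by (simp flip: free_const_mult)
  ultimately have vX: "vX e f \<doteq> \<gamma> * free_const (V $ e $ f)" for e f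
    by (simp add: \<gamma>_def flip: mult.assoc)
  have "(X ** free_const_mat K) $ (a, b) $ (e, f) \<doteq> \<gamma> * free_const (K $ (a, b) $ (e, f))" for a b e f
  proof -
    have "(X ** free_const_mat K) $ (a, b) $ (e, f) \<doteq> free_const (U $ a $ b) * vX e f"
      unfolding KX[symmetric] by (rule eqv_sym[OF mat_eqv_nth[OF K_X]])
    also have "\<dots> \<doteq> free_const (U $ a $ b) * (\<gamma> * free_const (V $ e $ f))"
      by (intro eqv_mult eqv_refl vX)
    finally show ?thesis by (simp add: K_nth free_const_mult free_const_left_commute[of \<gamma>])
  qed
  then show thesis using vX by (intro that) (auto simp: vX_def split_paired_all)
qed

lemma two_contraction_eqv:
  assumes "\<And>x y. (X ** free_const_mat K) $ x $ y \<doteq> \<gamma> * free_const (K $ x $ y)"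
  shows "two_contraction q \<mu> R F M \<doteq> \<gamma> * free_const (\<mu> * \<mu>)"
proof -
  let ?D = "on1 (D_op R) ** on2 (D_op R)"
  have "trace (free_const_mat ?D ** (X ** free_const_mat K)) \<doteq> (\<Sum>x\<in>UNIV. \<gamma> * free_const ((?D ** K) $ x $ x))"
    unfolding trace_def by (intro eqv_sum const_mult_eqv assms)
  also have "\<dots> = \<gamma> * free_const (\<mu> * \<mu> * eta q \<mu>)"
    by (simp add: trace_def free_const_sum sum_distrib_left flip: trace_DD_K)
  finally have "two_contraction q \<mu> R F M \<doteq>
      free_const (inverse (eta q \<mu>)) * (\<gamma> * free_const (\<mu> * \<mu> * eta q \<mu>))"
    unfolding two_contraction_def X_def[symmetric] K_def[symmetric] free_const_mat_mult[symmetric]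
    by (intro eqv_mult eqv_refl)
  also have "\<dots> = \<gamma> * free_const (\<mu> * \<mu>)"
    using eta by (simp add: field_simps flip: free_const_left_commute[of \<gamma>] free_const_mult)
  finally show ?thesis .
qed

text \<open>\<open>M\<close> in factor 1 commutes with \<open>D_R\<close> in factor 2, so it moves
  inside the trace and completes the conjugated copy in \<open>xi\<close> to \<open>X\<close>. Then
  \<open>X K\<close> is replaced by \<gamma> \<open>K\<close>, and \<open>tr_D_K\<close> supplies
  \<mu>.\<close>

lemma M_xi_eqv:
  assumes "\<And>x y. (X ** free_const_mat K) $ x $ y \<doteq> \<gamma> * free_const (K $ x $ y)"
  shows "(M ** xi q \<mu> R F M) $ i $ j \<doteq> \<gamma> * free_const (mat \<mu> $ i $ j)"
proof -
  have "M ** xi q \<mu> R F M = tr2of2 (free_const_mat (on2 (D_op R)) ** (X ** free_const_mat K))"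
    unfolding xi_def tr2of2_on1_mult[symmetric] X_def M_bar1_def M_bar2_def K_def
    by (simp add: matrix_mul_assoc on1_free_const_on2_commute)
  also have "\<dots> $ i $ j \<doteq> (\<Sum>b\<in>UNIV. \<gamma> * free_const ((on2 (D_op R) ** K) $ (i, b) $ (j, b)))"
    unfolding tr2of2_nth by (intro eqv_sum const_mult_eqv assms)
  also have "\<dots> = \<gamma> * free_const (mat \<mu> $ i $ j)"
    by (simp add: free_const_sum sum_distrib_left flip: tr_D_K)
  finally show ?thesis .
qed

lemma M_right_inverse:
  "M ** (\<chi> a b. free_const \<mu> * xi q \<mu> R F M $ a $ b * g') \<doteq>\<doteq> mat 1" (is "M ** ?N \<doteq>\<doteq> _")
proof -
  obtain \<gamma> where "\<forall>x y. (X ** free_const_mat K) $ x $ y \<doteq> \<gamma> * free_const (K $ x $ y)"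
    by (rule contraction_eigenvalue)
  then have \<gamma>: "\<And>x y. (X ** free_const_mat K) $ x $ y \<doteq> \<gamma> * free_const (K $ x $ y)"
    by blast
  let ?g = "two_contraction q \<mu> R F M"
  have "(M ** ?N) $ i $ j \<doteq> mat 1 $ i $ j" for i j
  proof -
    have "(M ** ?N) $ i $ j = free_const \<mu> * (M ** xi q \<mu> R F M) $ i $ j * g'"
      by (simp add: matrix_mult_nth sum_distrib_left sum_distrib_right mult.assoc
          free_const_left_commute[of "M $ _ $ _"])
    also have "\<dots> \<doteq> free_const \<mu> * (\<gamma> * free_const (mat \<mu> $ i $ j)) * g'"
      by (intro eqv_mult eqv_refl M_xi_eqv \<gamma>)
    also have "\<dots> = mat 1 $ i $ j * (\<gamma> * free_const (\<mu> * \<mu>) * g')"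
      by (simp add: mat_nth free_const_mult free_const_left_commute[of \<gamma>] flip: mult.assoc)
        (simp add: mult.assoc free_const_left_commute[of \<gamma>])
    also have "\<dots> \<doteq> mat 1 $ i $ j * (?g * g')"
      by (intro eqv_mult eqv_refl eqv_sym[OF two_contraction_eqv] \<gamma>)
    also have "\<dots> \<doteq> mat 1 $ i $ j * 1"
      using g'_right by (intro eqv_mult eqv_refl) (simp add: eqv_def)
    finally show ?thesis by simp
  qed
  then show ?thesis by (simp add: mat_eqv_def)
qed

lemma M_left_inverse: obtains L where "L ** M \<doteq>\<doteq> mat 1"
proof -
  let ?g = "two_contraction q \<mu> R F M"
  obtain \<gamma> where *: "\<forall>e f. (\<Sum>a\<in>UNIV. \<Sum>b\<in>UNIV. free_const (V $ a $ b) * X $ (a, b) $ (e, f))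
      \<doteq> \<gamma> * free_const (V $ e $ f)"
    "\<forall>x y. (X ** free_const_mat K) $ x $ y \<doteq> \<gamma> * free_const (K $ x $ y)"
    by (rule contraction_eigenvalue)
  from *(1) have vX: "\<And>e f. (\<Sum>a\<in>UNIV. \<Sum>b\<in>UNIV. free_const (V $ a $ b) * X $ (a, b) $ (e, f))
      \<doteq> \<gamma> * free_const (V $ e $ f)" by blast
  from *(2) have \<gamma>: "\<And>x y. (X ** free_const_mat K) $ x $ y \<doteq> \<gamma> * free_const (K $ x $ y)"
    by blast
  define Y where "Y = on1 M ** free_const_mat F"
  \<comment> \<open>\<open>P\<close> is \<open>v M1 F\<close> with its two free indices exchanged,
    so that the remaining \<open>M1\<close> becomes an ordinary right factor \<open>M\<close>; this
    is why the transpose of \<open>W F\<close> appears.\<close>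
  define P where "P = (\<chi> f d. \<Sum>a\<in>UNIV. \<Sum>b\<in>UNIV. free_const (V $ a $ b) * Y $ (a, b) $ (d, f))"
  have "free_const_mat (matrix_inv F) ** free_const_mat F = (mat 1 :: ('g free_alg, 'n) op2)"
    using F by (simp add: is_R_matrix_def matrix_inv_mult free_const_mat_mat flip: free_const_mat_mult)
  then have XF: "X ** free_const_mat F = Y ** on1 M"
    by (simp add: X_def Y_def M_bar1_def M_bar2_def flip: matrix_mul_assoc)
  have PM: "(P ** M) $ f $ e \<doteq> \<gamma> * free_const (transpose (W F) $ f $ e)" for f e
  proof -
    have "(P ** M) $ f $ e = (\<Sum>d\<in>UNIV. \<Sum>a\<in>UNIV. \<Sum>b\<in>UNIV. free_const (V $ a $ b) * (Y $ (a, b) $ (d, f) * M $ d $ e))"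
      by (simp add: matrix_mult_nth P_def sum_distrib_right mult.assoc)
    also have "\<dots> = (\<Sum>a\<in>UNIV. \<Sum>b\<in>UNIV. free_const (V $ a $ b) * (Y ** on1 M) $ (a, b) $ (e, f))"
      by (subst sum.swap, rule sum.cong[OF refl], subst sum.swap)
        (simp add: matrix_mult_nth sum_UNIV_prod mult_if_zero sum_distrib_left cong: if_cong)
    also have "\<dots> = (\<Sum>a\<in>UNIV. \<Sum>b\<in>UNIV. \<Sum>c\<in>UNIV. \<Sum>d\<in>UNIV.
        free_const (V $ a $ b) * X $ (a, b) $ (c, d) * free_const (F $ (c, d) $ (e, f)))"
      unfolding XF[symmetric]
      by (simp add: matrix_mult_nth sum_UNIV_prod sum_distrib_left mult.assoc)
    also have "\<dots> = (\<Sum>c\<in>UNIV. \<Sum>d\<in>UNIV.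
        (\<Sum>a\<in>UNIV. \<Sum>b\<in>UNIV. free_const (V $ a $ b) * X $ (a, b) $ (c, d)) * free_const (F $ (c, d) $ (e, f)))"
      by (rule trans[OF sum_swap_pairs]) (simp add: sum_distrib_right)
    also have "\<dots> \<doteq> (\<Sum>c\<in>UNIV. \<Sum>d\<in>UNIV. (\<gamma> * free_const (V $ c $ d)) * free_const (F $ (c, d) $ (e, f)))"
      by (intro eqv_sum eqv_mult eqv_refl vX)
    also have "\<dots> = \<gamma> * free_const (transpose (W F) $ f $ e)"
      by (simp add: W_def transpose_def free_const_sum free_const_mult sum_distrib_left mult.assoc)
    finally show ?thesis .
  qed
  have W_inv: "transpose (matrix_inv (W F)) ** transpose (W F) = mat 1"
    using matrix_inv_mult(1)[OF invertible_W[OF F RF]] by (metis matrix_transpose_mul transpose_mat)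
  define Q where "Q = free_const_mat (transpose (matrix_inv (W F))) ** P"
  have QM: "(Q ** M) $ i $ j \<doteq> \<gamma> * free_const (mat 1 $ i $ j)" for i j
    unfolding Q_def matrix_mul_assoc[symmetric] W_inv[symmetric] by (intro const_mult_eqv PM)
  \<comment> \<open>The constant comes from \<open>two_contraction_eqv\<close>:
    \<open>\<gamma> \<mu>^2\<close> is the 2-contraction, which \<open>g'\<close> inverts from the
    left.\<close>
  have "(mat (g' * free_const (\<mu> * \<mu>)) ** Q ** M) $ i $ j \<doteq> mat 1 $ i $ j" for i j
  proof -
    have "(mat (g' * free_const (\<mu> * \<mu>)) ** Q ** M) $ i $ j
        = g' * free_const (\<mu> * \<mu>) * (Q ** M) $ i $ j"
      by (simp flip: matrix_mul_assoc)
    also have "\<dots> \<doteq> g' * free_const (\<mu> * \<mu>) * (\<gamma> * free_const (mat 1 $ i $ j))"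
      by (intro eqv_mult eqv_refl QM)
    also have "\<dots> = g' * (\<gamma> * free_const (\<mu> * \<mu>)) * mat 1 $ i $ j"
      by (simp add: mat_nth mult.assoc free_const_commute[of \<gamma>])
    also have "\<dots> \<doteq> g' * ?g * mat 1 $ i $ j"
      by (intro eqv_mult eqv_refl eqv_sym[OF two_contraction_eqv] \<gamma>)
    also have "\<dots> \<doteq> 1 * mat 1 $ i $ j"
      using g'_left by (intro eqv_mult eqv_refl) (simp add: eqv_def)
    finally show ?thesis by simp
  qed
  then have "mat (g' * free_const (\<mu> * \<mu>)) ** Q ** M \<doteq>\<doteq> mat 1"
    by (simp add: mat_eqv_def)
  then show thesis by (rule that)
qed

lemma M_inverse:
  "(\<chi> a b. free_const \<mu> * xi q \<mu> R F M $ a $ b * g') ** M \<doteq>\<doteq> mat 1"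
  by (rule M_left_inverse) (rule mat_eqv_left_right_inverse[OF _ M_right_inverse])

end

section \<open>Passage to the extended quantum matrix algebra\<close>

theorem mainTheorem14:
  fixes R F :: "complex ^ ('n::finite \<times> 'n) ^ ('n \<times> 'n)"
    and q \<mu> :: complex
  assumes "q \<notin> {0, 1, - 1}"
    and "\<mu> \<notin> {0, q, - inverse q}"
    and "is_R_matrix R" and "strict_skew_invertible R"
    and "is_R_matrix F" and "strict_skew_invertible F"
    and "compatible_pair R F"
    and "is_BMW_type q \<mu> R"
  shows "(\<forall>a b. qma_M_inv q \<mu> R F $ a $ b \<in> carrier (qma_ext q \<mu> R F)) \<and>
    ring_mat_mult (qma_ext q \<mu> R F) (qma_M q \<mu> R F) (qma_M_inv q \<mu> R F)
      = ring_mat_one (qma_ext q \<mu> R F) \<and>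
    ring_mat_mult (qma_ext q \<mu> R F) (qma_M_inv q \<mu> R F) (qma_M q \<mu> R F)
      = ring_mat_one (qma_ext q \<mu> R F)"
proof -
  interpret BMW R q \<mu>
    using assms by unfold_locales auto
  obtain U V :: "complex ^ 'n ^ 'n" where UV: "invertible U" "invertible V"
    "\<And>a b c d. K $ (a, b) $ (c, d) = U $ a $ b * V $ c $ d"
    using K_rank_one[OF assms(4)] by metis
  \<comment> \<open>The excluded values \<open>q\<close> and \<open>- inverse q\<close> of \<mu> are
    exactly the zeros of the numerator of \<open>eta\<close>.\<close>
  have "eta q \<mu> \<noteq> 0"
    using assms(2) h_nonzero by (auto simp: eta_def h_def add_eq_0_iff)
  interpret BMW_rank_one R q \<mu> U V
    using assms(4) UV by unfold_locales auto
  let ?S = "ext_relators q \<mu> R F :: 'n qma_gen free_alg set"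
  have S: "qma_relators R F M_gen \<subseteq> ?S"
    "g_inv * two_contraction q \<mu> R F M_gen - 1 \<in> ?S" "two_contraction q \<mu> R F M_gen * g_inv - 1 \<in> ?S"
    by (auto simp: ext_relators_def Let_def)
  interpret two_sided_ideal "Idl\<^bsub>free_alg_ring\<^esub> ?S"
    by (rule two_sided_ideal_Idl)
  interpret qma_ideal R q \<mu> U V "Idl\<^bsub>free_alg_ring\<^esub> ?S" F M_gen g_inv
    using assms(5,7) \<open>eta q \<mu> \<noteq> 0\<close> S Idl_superset[of ?S] by unfold_locales auto
  show ?thesis
    using presented_class_mat_eqI[OF M_right_inverse] presented_class_mat_eqI[OF M_inverse]
    by (simp add: qma_ext_def qma_M_def qma_M_inv_def ring_mat_mult_presented ring_mat_one_presented)
      (simp add: presented_class_mat_def presented_class_carrier)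
qed

end
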